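(* Let $V,U\ge 0$ be independent random variables with $\mathbb{E}[V]=\mathbb{E}[U]=1$, variances $\sigma_V^2,\sigma_U^2$ satisfying $0<\sigma_V^2+\sigma_U^2<\infty$, and such that for some $\delta>0$ the functions $z\mapsto \mathbb{E}[e^{zV}]$ and $z\mapsto\mathbb{E}[e^{zU}]$ are analytic in an open strip containing $-\delta\le \mathrm{Re}(z)\le\delta$. Let $\rho_n\in(0,1)$, $n=1,2,\dots$, be such that there are fixed $0<\beta_1\le\beta_2<\infty$ with $(1-\rho_n)\,n\in[\beta_1,\beta_2]$ for all $n$. Let $W_n$ be the steady-state waiting time of the nearly deterministic $\mathrm{GI}_n/\mathrm{G}_n/1$ queue built from $V,U,\rho_n$, and let $\gamma_n=(\sigma_V^2+\rho_n^{-2}\sigma_U^2)\,\rho_n/(2n(1-\rho_n))$. Then for every fixed $k=1,2,\dots$ $$\mathbb{E}\big[W_n^k\big]=k!\,\gamma_n^k+O\Big(\frac{\log n}{\sqrt n}\Big),\qquad n\to\infty .$$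
   Context: Nearly deterministic $\mathrm{GI}_n/\mathrm{G}_n/1$ queue: $V_n=\frac1n\sum_{k=1}^n V_{n,k}$ and $U_n=\frac1n\sum_{k=1}^nU_{n,k}$, where the $V_{n,k}$ are i.i.d. copies of $V$, the $U_{n,k}$ are i.i.d. copies of $U$, and all of these are independent. The steady-state waiting time $W_n\ge0$ is the (finite) random variable whose distribution is the stationary solution of $W_n\stackrel{d}{=}\big(W_n+V_n-\frac1{\rho_n}U_n\big)^+$, where $x^+=\max\{0,x\}$ and on the right-hand side $W_n,V_n,U_n$ are independent. *)

theory Defs
  imports
    "HOL-Probability.Probability"
    "HOL-Complex_Analysis.Complex_Analysis"
    "HOL-Library.Landau_Symbols"
begin

definition complex_mgf :: "'a measure \<Rightarrow> ('a \<Rightarrow> real) \<Rightarrow> complex \<Rightarrow> complex" where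
  "complex_mgf M X z = (LINT \<omega>|M. exp (z * complex_of_real (X \<omega>)))"

(* The Bochner integral of a non-integrable function is 0, so existence of the
   expectation on the strip is demanded explicitly. *)
definition mgf_analytic_beyond_strip :: "'a measure \<Rightarrow> ('a \<Rightarrow> real) \<Rightarrow> real \<Rightarrow> bool" where
  "mgf_analytic_beyond_strip M X \<delta> \<longleftrightarrow>
     (\<exists>a b. a < -\<delta> \<and> \<delta> < b \<and>
       (\<forall>z. a < Re z \<and> Re z < b \<longrightarrow>
          integrable M (\<lambda>\<omega>. exp (z * complex_of_real (X \<omega>)))) \<and>
       complex_mgf M X analytic_on {z. a < Re z \<and> Re z < b})"

(* Row n of the array consists of X n 1, ..., X n n; other entries are never used. *)
definition row_mean :: "(nat \<Rightarrow> nat \<Rightarrow> 'a \<Rightarrow> real) \<Rightarrow> nat \<Rightarrow> 'a \<Rightarrow> real" where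
  "row_mean X n \<omega> = (1 / real n) * (\<Sum>k=1..n. X n k \<omega>)"

(* Independence is only required within each row, jointly for both arrays: the queues
   for different n need not be related. *)
definition iid_copy_arrays ::
  "'a measure \<Rightarrow> ('a \<Rightarrow> real) \<Rightarrow> ('a \<Rightarrow> real) \<Rightarrow>
   (nat \<Rightarrow> nat \<Rightarrow> 'a \<Rightarrow> real) \<Rightarrow> (nat \<Rightarrow> nat \<Rightarrow> 'a \<Rightarrow> real) \<Rightarrow> bool" where
  "iid_copy_arrays M V U VV UU \<longleftrightarrow>
     (\<forall>n\<ge>1.
        (\<forall>k\<in>{1..n}. distr M borel (VV n k) = distr M borel V \<and>
                    distr M borel (UU n k) = distr M borel U) \<and>
        prob_space.indep_vars M (\<lambda>_. borel) (case_sum (VV n) (UU n)) ({1..n} <+> {1..n}))"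

(* W =d (W + X - Y / r)^+ with W, X, Y independent on the right: the joint law there is
   the product of the marginal laws, whatever the joint law of W, X, Y on M is. *)
definition steady_state_waiting_time ::
  "'a measure \<Rightarrow> ('a \<Rightarrow> real) \<Rightarrow> ('a \<Rightarrow> real) \<Rightarrow> real \<Rightarrow> ('a \<Rightarrow> real) \<Rightarrow> bool" where
  "steady_state_waiting_time M X Y r W \<longleftrightarrow>
     W \<in> borel_measurable M \<and> (AE \<omega> in M. 0 \<le> W \<omega>) \<and>
     distr M borel W =
       distr (distr M borel W \<Otimes>\<^sub>M (distr M borel X \<Otimes>\<^sub>M distr M borel Y)) borel
         (\<lambda>(w, x, y). max 0 (w + x - (1 / r) * y))"

end

theory Submission
  imports Defs "HOL-Real_Asymp.Real_Asymp"
begin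

text \<open>
  Let \<open>X\<close> be the increment, \<open>m = - E X\<close>, and \<open>I = (W + X)\<^sup>-\<close>. Since
  \<open>y\<^sup>k\<^sup>+\<^sup>1 = (y\<^sup>+)\<^sup>k\<^sup>+\<^sup>1 + (-1)\<^sup>k\<^sup>+\<^sup>1 (y\<^sup>-)\<^sup>k\<^sup>+\<^sup>1\<close> and \<open>(W + X)\<^sup>+\<close> has the law of \<open>W\<close>, expanding
  \<open>E (W + X)\<^sup>k\<^sup>+\<^sup>1\<close> gives a recursion for the moments of \<open>W\<close> whose only unknown term is
  \<open>E I\<^sup>k\<^sup>+\<^sup>1\<close>. For \<open>k = 0\<close> it says \<open>E I = m\<close>, which is of order \<open>1/n\<close>. As \<open>I \<le> |X|\<close> and \<open>sqrt n |X|\<close>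
  has uniformly bounded exponential moments, \<open>I\<close> exceeds a multiple of \<open>ln n / sqrt n\<close> only with
  negligible contribution, so \<open>E I\<^sup>k\<^sup>+\<^sup>1 = O(m ln n / sqrt n)\<close> for \<open>k \<ge> 1\<close>. Dividing the recursion by \<open>m\<close> yields
  \<open>E W\<^sup>k = k \<gamma> E W\<^sup>k\<^sup>-\<^sup>1 + O(ln n / sqrt n)\<close>.
\<close>

section \<open>Exponential moments\<close>

text \<open>A single term of the exponential series, all of whose terms are nonnegative, is at most
  the whole sum.\<close>

lemma power_le_fact_mult_exp:
  fixes x :: real
  assumes "0 \<le> x"
  shows "x ^ j \<le> fact j * exp x"
proof -
  have "(\<Sum>i\<in>{j}. x ^ i /\<^sub>R fact i) \<le> (\<Sum>i. x ^ i /\<^sub>R fact i)"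
    using assms summable_exp_generic[of x] by (intro sum_le_suminf) auto
  then show ?thesis
    by (simp add: exp_def field_simps)
qed

lemma power_le_fact_mult_exp_scaled:
  fixes x s :: real
  assumes "0 \<le> x" "0 < s"
  shows "x ^ j \<le> fact j / s ^ j * exp (s * x)"
  using power_le_fact_mult_exp[of "s * x" j] assms by (simp add: power_mult_distrib field_simps)

text \<open>Taylor's formula with Lagrange remainder of order two; the intermediate point is only
  known to satisfy \<open>\<bar>t\<bar> \<le> \<bar>x\<bar>\<close>, hence the absolute value in the
  exponent. Keeping \<open>1 + x\<close> exact lets the mean enter exactly after
  integration.\<close>

lemma exp_le_quadratic:
  fixes x :: real
  shows "exp x \<le> 1 + x + x\<^sup>2 * exp \<bar>x\<bar>"
proof -
  obtain t where t: "\<bar>t\<bar> \<le> \<bar>x\<bar>" "exp x = (\<Sum>m<2. x ^ m / fact m) + exp t / fact 2 * x ^ 2"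
    using Maclaurin_exp_le[of x 2] by blast
  have "exp t / fact 2 * x\<^sup>2 \<le> exp \<bar>x\<bar> / fact 1 * x\<^sup>2"
    using t(1) by (intro mult_right_mono frac_le) auto
  with t(2) show ?thesis
    by (simp add: numeral_2_eq_2 mult.commute)
qed

lemma (in pair_sigma_finite)
  fixes f :: "'a \<Rightarrow> real" and g :: "'b \<Rightarrow> real"
  assumes f: "integrable M1 f" and g: "integrable M2 g"
  shows integrable_mult_fst_snd: "integrable (M1 \<Otimes>\<^sub>M M2) (\<lambda>(x, y). f x * g y)"
    and integral_mult_fst_snd:
      "integral\<^sup>L (M1 \<Otimes>\<^sub>M M2) (\<lambda>(x, y). f x * g y) = (LINT x|M1. f x) * (LINT y|M2. g y)"
proof -
  have [measurable]: "f \<in> borel_measurable M1" "g \<in> borel_measurable M2"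
    using f g by auto
  show *: "integrable (M1 \<Otimes>\<^sub>M M2) (\<lambda>(x, y). f x * g y)"
    using f g by (intro Fubini_integrable) (auto simp: abs_mult)
  show "integral\<^sup>L (M1 \<Otimes>\<^sub>M M2) (\<lambda>(x, y). f x * g y) = (LINT x|M1. f x) * (LINT y|M2. g y)"
    using integral_fst'[OF *] by simp
qed

text \<open>The quadratic remainder carries \<open>exp (\<delta> / 2 * \<bar>Z x\<bar>)\<close>; the
  other half of the rate \<open>\<delta>\<close> absorbs the factor \<open>(Z x)\<^sup>2\<close>.
  The constant \<open>K\<close> serves all small \<open>s\<close> at once, which later gives bounds
  uniform in the sample size.\<close>

lemma (in prob_space) exp_moment_quadratic_bound:
  fixes Z :: "'a \<Rightarrow> real"
  assumes [measurable]: "Z \<in> borel_measurable M"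
    and "0 < \<delta>" and int: "integrable M (\<lambda>x. exp (\<delta> * \<bar>Z x\<bar>))"
  obtains K where "0 \<le> K"
    "\<And>s. \<bar>s\<bar> \<le> \<delta> / 2 \<Longrightarrow> integrable M (\<lambda>x. exp (s * Z x))"
    "\<And>s. \<bar>s\<bar> \<le> \<delta> / 2 \<Longrightarrow> expectation (\<lambda>x. exp (s * Z x)) \<le> 1 + s * expectation Z + s\<^sup>2 * K"
proof
  let ?K = "expectation (\<lambda>x. (Z x)\<^sup>2 * exp (\<delta> / 2 * \<bar>Z x\<bar>))"
  have intZ: "integrable M Z"
  proof (rule Bochner_Integration.integrable_bound)
    show "integrable M (\<lambda>x. fact 1 / \<delta> ^ 1 * exp (\<delta> * \<bar>Z x\<bar>))"
      using int by auto
    show "AE x in M. norm (Z x) \<le> norm (fact 1 / \<delta> ^ 1 * exp (\<delta> * \<bar>Z x\<bar>))"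
      using power_le_fact_mult_exp_scaled[of "\<bar>Z _\<bar>" \<delta> 1] \<open>0 < \<delta>\<close> by auto
  qed simp
  have intK: "integrable M (\<lambda>x. (Z x)\<^sup>2 * exp (\<delta> / 2 * \<bar>Z x\<bar>))"
  proof (rule Bochner_Integration.integrable_bound)
    show "integrable M (\<lambda>x. fact 2 / (\<delta> / 2)\<^sup>2 * exp (\<delta> * \<bar>Z x\<bar>))"
      using int by auto
    have "\<bar>z\<bar>\<^sup>2 * exp (\<delta> / 2 * \<bar>z\<bar>) \<le> fact 2 / (\<delta> / 2)\<^sup>2 * exp (\<delta> / 2 * \<bar>z\<bar>) * exp (\<delta> / 2 * \<bar>z\<bar>)" for z
      using \<open>0 < \<delta>\<close> by (intro mult_right_mono power_le_fact_mult_exp_scaled) auto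
    then show "AE x in M. norm ((Z x)\<^sup>2 * exp (\<delta> / 2 * \<bar>Z x\<bar>)) \<le> norm (fact 2 / (\<delta> / 2)\<^sup>2 * exp (\<delta> * \<bar>Z x\<bar>))"
      by (simp add: mult.assoc flip: exp_add)
  qed simp
  show "0 \<le> ?K"
    by (intro integral_nonneg_AE) auto
  fix s assume s: "\<bar>s\<bar> \<le> \<delta> / 2"
  have bound: "exp (s * z) \<le> 1 + s * z + s\<^sup>2 * (z\<^sup>2 * exp (\<delta> / 2 * \<bar>z\<bar>))" for z
  proof -
    have "exp (s * z) \<le> 1 + s * z + (s * z)\<^sup>2 * exp \<bar>s * z\<bar>"
      by (rule exp_le_quadratic)
    also have "\<dots> \<le> 1 + s * z + (s * z)\<^sup>2 * exp (\<delta> / 2 * \<bar>z\<bar>)"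
      using mult_right_mono[OF s, of "\<bar>z\<bar>"]
      by (intro add_left_mono mult_left_mono) (auto simp: abs_mult)
    finally show ?thesis
      by (simp add: power_mult_distrib mult.assoc)
  qed
  have int_rhs: "integrable M (\<lambda>x. 1 + s * Z x + s\<^sup>2 * ((Z x)\<^sup>2 * exp (\<delta> / 2 * \<bar>Z x\<bar>)))"
    using intZ intK by auto
  show ints: "integrable M (\<lambda>x. exp (s * Z x))"
  proof (rule Bochner_Integration.integrable_bound[OF int_rhs])
    show "AE x in M. norm (exp (s * Z x)) \<le> norm (1 + s * Z x + s\<^sup>2 * ((Z x)\<^sup>2 * exp (\<delta> / 2 * \<bar>Z x\<bar>)))"
      using bound by (auto intro: order.trans[OF _ abs_ge_self])
  qed simp
  have "expectation (\<lambda>x. exp (s * Z x)) \<le> expectation (\<lambda>x. 1 + s * Z x + s\<^sup>2 * ((Z x)\<^sup>2 * exp (\<delta> / 2 * \<bar>Z x\<bar>)))"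
    by (intro integral_mono[OF ints int_rhs] bound)
  also have "\<dots> = 1 + s * expectation Z + s\<^sup>2 * ?K"
    using intZ intK by (simp add: prob_space)
  finally show "expectation (\<lambda>x. exp (s * Z x)) \<le> 1 + s * expectation Z + s\<^sup>2 * ?K" .
qed

text \<open>Near the origin the negative linear term \<open>s * expectation Z\<close> outweighs the
  quadratic one.\<close>

lemma (in prob_space) exp_moment_less_1:
  fixes Z :: "'a \<Rightarrow> real"
  assumes "Z \<in> borel_measurable M" "0 < \<delta>" "integrable M (\<lambda>x. exp (\<delta> * \<bar>Z x\<bar>))"
    and "expectation Z < 0"
  obtains \<theta> where "0 < \<theta>" "integrable M (\<lambda>x. exp (\<theta> * Z x))" "expectation (\<lambda>x. exp (\<theta> * Z x)) < 1"
proof -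
  obtain K where K: "0 \<le> K"
    "\<And>s. \<bar>s\<bar> \<le> \<delta> / 2 \<Longrightarrow> integrable M (\<lambda>x. exp (s * Z x))"
    "\<And>s. \<bar>s\<bar> \<le> \<delta> / 2 \<Longrightarrow> expectation (\<lambda>x. exp (s * Z x)) \<le> 1 + s * expectation Z + s\<^sup>2 * K"
    using exp_moment_quadratic_bound[OF assms(1-3)] by blast
  \<comment> \<open>\<open>K + 1\<close> keeps the denominator positive when \<open>K = 0\<close>.
    The choice gives \<open>\<theta> * K < - expectation Z\<close> strictly, so the correction to 1
    is negative.\<close>
  define \<theta> where "\<theta> = min (\<delta> / 2) (- expectation Z / (2 * (K + 1)))"
  have "0 < - expectation Z / (2 * (K + 1))"
    using assms(4) K(1) by (intro divide_pos_pos) auto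
  then have \<theta>: "0 < \<theta>" "\<bar>\<theta>\<bar> \<le> \<delta> / 2"
    using assms(2) unfolding \<theta>_def by linarith+
  have "\<theta> * (2 * (K + 1)) \<le> - expectation Z"
    using K(1) min.cobounded2[of "\<delta> / 2" "- expectation Z / (2 * (K + 1))"]
    unfolding \<theta>_def[symmetric] by (simp add: field_simps)
  moreover have "\<theta> * K < \<theta> * (2 * (K + 1))"
    using \<theta>(1) K(1) by (intro mult_strict_left_mono) auto
  ultimately have "\<theta> * (expectation Z + \<theta> * K) < 0"
    using \<theta>(1) by (intro mult_pos_neg; linarith)
  then have "expectation (\<lambda>x. exp (\<theta> * Z x)) < 1"
    using K(3)[OF \<theta>(2)] by (simp add: algebra_simps power2_eq_square)
  with \<theta> K(2) that show thesis by blast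
qed

section \<open>Moments of the stationary Lindley recursion\<close>

text \<open>Only the law \<open>\<mu>\<close> of the waiting time enters. The product measure
  encodes independence of waiting time and increment, and \<open>N\<close> may be any probability
  space, so that it can later carry the pair of service and interarrival means.\<close>

locale lindley_equilibrium = pair_prob_space \<mu> N for \<mu> :: "real measure" and N :: "'b measure" +
  fixes X :: "'b \<Rightarrow> real"
  assumes sets_equilibrium [measurable_cong]: "sets \<mu> = sets borel"
    and measurable_increment [measurable]: "X \<in> borel_measurable N"
    and equilibrium_nonneg: "AE w in \<mu>. 0 \<le> w"
    and stationary: "distr (\<mu> \<Otimes>\<^sub>M N) borel (\<lambda>(w, z). max 0 (w + X z)) = \<mu>"
begin

lemma integral_stationary:
  fixes h :: "real \<Rightarrow> real"
  assumes [measurable]: "h \<in> borel_measurable borel"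
  shows "(\<integral>w. h w \<partial>\<mu>) = integral\<^sup>L (\<mu> \<Otimes>\<^sub>M N) (\<lambda>(w, z). h (max 0 (w + X z)))"
proof -
  have "(\<integral>w. h w \<partial>\<mu>) = (\<integral>w. h w \<partial>distr (\<mu> \<Otimes>\<^sub>M N) borel (\<lambda>(w, z). max 0 (w + X z)))"
    by (simp add: stationary)
  also have "\<dots> = integral\<^sup>L (\<mu> \<Otimes>\<^sub>M N) (\<lambda>(w, z). h (max 0 (w + X z)))"
    by (subst integral_distr) (auto simp: case_prod_unfold)
  finally show ?thesis .
qed

lemma integrable_stationary:
  fixes h :: "real \<Rightarrow> real"
  assumes [measurable]: "h \<in> borel_measurable borel" and "integrable \<mu> h"
  shows "integrable (\<mu> \<Otimes>\<^sub>M N) (\<lambda>(w, z). h (max 0 (w + X z)))"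
proof -
  have "integrable (distr (\<mu> \<Otimes>\<^sub>M N) borel (\<lambda>(w, z). max 0 (w + X z))) h"
    using assms by (simp add: stationary)
  then show ?thesis
    by (subst (asm) integrable_distr_eq) (auto simp: case_prod_unfold)
qed

text \<open>
  The bound must not presuppose that \<open>E exp (\<theta> W)\<close> is finite, so stationarity is iterated on the
  truncations \<open>min b (exp (\<theta> w))\<close>: with \<open>q = E exp (\<theta> X) < 1\<close>, the contribution of the starting value is
  damped by \<open>q\<^sup>j\<close> after \<open>j\<close> steps, leaving a bound \<open>1 / (1 - q)\<close> independent of \<open>b\<close>.
\<close>
lemma integrable_exp_equilibrium:
  assumes "0 < \<theta>" and int: "integrable N (\<lambda>z. exp (\<theta> * X z))"
    and less_1: "(\<integral>z. exp (\<theta> * X z) \<partial>N) < 1"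
  shows "integrable \<mu> (\<lambda>w. exp (\<theta> * w))"
proof -
  define q where "q = (\<integral>z. exp (\<theta> * X z) \<partial>N)"
  have q: "0 \<le> q" "q < 1"
    using less_1 by (auto simp: q_def)
  \<comment> \<open>Integrating out the increment first,
    \<open>exp (\<theta> * max 0 y) \<le> 1 + exp (\<theta> * y)\<close> turns the coefficients
    \<open>(c, p)\<close> into \<open>(c + p, p * q)\<close>. The truncation at \<open>b\<close>
    makes every integrand bounded.\<close>
  have step: "(\<integral>w. min b (c + p * exp (\<theta> * w)) \<partial>\<mu>) \<le> (\<integral>w. min b (c + p + p * q * exp (\<theta> * w)) \<partial>\<mu>)"
    if "0 \<le> b" "0 \<le> c" "0 \<le> p" for b c p
  proof -
    have int_pair: "integrable (\<mu> \<Otimes>\<^sub>M N) (\<lambda>(w, z). min b (c + p * exp (\<theta> * max 0 (w + X z))))"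
      using that by (intro P.integrable_const_bound[where B = b]) (auto simp: case_prod_unfold)
    have int_fst: "integrable N (\<lambda>z. min b (c + p * exp (\<theta> * max 0 (w + X z))))" for w
      using that by (intro M2.integrable_const_bound[where B = b]) auto
    have inner: "(\<integral>z. min b (c + p * exp (\<theta> * max 0 (w + X z))) \<partial>N) \<le> min b (c + p + p * q * exp (\<theta> * w))" for w
    proof (rule min.boundedI)
      have "(\<integral>z. min b (c + p * exp (\<theta> * max 0 (w + X z))) \<partial>N) \<le> (\<integral>z. b \<partial>N)"
        by (intro integral_mono int_fst) auto
      then show "(\<integral>z. min b (c + p * exp (\<theta> * max 0 (w + X z))) \<partial>N) \<le> b"
        by (simp add: M2.prob_space)
      have "min b (c + p * exp (\<theta> * max 0 (w + x))) \<le> c + p + p * exp (\<theta> * w) * exp (\<theta> * x)" for x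
      proof -
        have "exp (\<theta> * max 0 (w + x)) \<le> 1 + exp (\<theta> * w) * exp (\<theta> * x)"
          by (auto simp: max_def algebra_simps simp flip: exp_add)
        from mult_left_mono[OF this \<open>0 \<le> p\<close>] show ?thesis
          by (simp add: algebra_simps min.coboundedI2)
      qed
      then have "(\<integral>z. min b (c + p * exp (\<theta> * max 0 (w + X z))) \<partial>N)
          \<le> (\<integral>z. c + p + p * exp (\<theta> * w) * exp (\<theta> * X z) \<partial>N)"
        using int by (intro integral_mono int_fst) auto
      also have "\<dots> = c + p + p * q * exp (\<theta> * w)"
        using int by (simp add: q_def M2.prob_space)
      finally show "(\<integral>z. min b (c + p * exp (\<theta> * max 0 (w + X z))) \<partial>N) \<le> c + p + p * q * exp (\<theta> * w)" .
    qed
    have "(\<integral>w. min b (c + p * exp (\<theta> * w)) \<partial>\<mu>)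
        = (\<integral>w. (\<integral>z. min b (c + p * exp (\<theta> * max 0 (w + X z))) \<partial>N) \<partial>\<mu>)"
      using integral_fst'[OF int_pair] by (subst integral_stationary) auto
    also have "\<dots> \<le> (\<integral>w. min b (c + p + p * q * exp (\<theta> * w)) \<partial>\<mu>)"
    proof (intro integral_mono inner)
      show "integrable \<mu> (\<lambda>w. \<integral>z. min b (c + p * exp (\<theta> * max 0 (w + X z))) \<partial>N)"
        using integrable_fst'[OF int_pair] by simp
      show "integrable \<mu> (\<lambda>w. min b (c + p + p * q * exp (\<theta> * w)))"
        using that q by (intro M1.integrable_const_bound[where B = b]) auto
    qed
    finally show ?thesis .
  qed
  have iterate: "(\<integral>w. min b (exp (\<theta> * w)) \<partial>\<mu>) \<le> (\<integral>w. min b ((\<Sum>i<j. q ^ i) + q ^ j * exp (\<theta> * w)) \<partial>\<mu>)"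
    if "0 \<le> b" for b j
  proof (induction j)
    case (Suc j)
    also have "(\<integral>w. min b ((\<Sum>i<j. q ^ i) + q ^ j * exp (\<theta> * w)) \<partial>\<mu>)
        \<le> (\<integral>w. min b ((\<Sum>i<Suc j. q ^ i) + q ^ Suc j * exp (\<theta> * w)) \<partial>\<mu>)"
      using step[OF that, of "\<Sum>i<j. q ^ i" "q ^ j"] q by (simp add: sum_nonneg mult.commute)
    finally show ?case .
  qed simp
  have bound: "(\<integral>w. min b (exp (\<theta> * w)) \<partial>\<mu>) \<le> 1 / (1 - q)" if "0 \<le> b" for b
  proof -
    have "(\<lambda>j. \<integral>w. min b ((\<Sum>i<j. q ^ i) + q ^ j * exp (\<theta> * w)) \<partial>\<mu>)
        \<longlonglongrightarrow> (\<integral>w. min b (1 / (1 - q)) \<partial>\<mu>)"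
    \<comment> \<open>For fixed \<open>w\<close> the geometric sums tend to
      \<open>1 / (1 - q)\<close> and \<open>q ^ j\<close> kills the exponential; the truncation
      level itself is the dominating function.\<close>
    proof (rule integral_dominated_convergence[where w = "\<lambda>_. b"])
      have "(\<lambda>j. min b ((\<Sum>i<j. q ^ i) + q ^ j * exp (\<theta> * w))) \<longlonglongrightarrow> min b (1 / (1 - q) + 0 * exp (\<theta> * w))" for w
        using q geometric_sums[of q] by (intro tendsto_intros LIMSEQ_realpow_zero) (auto simp: sums_def)
      then show "AE w in \<mu>. (\<lambda>j. min b ((\<Sum>i<j. q ^ i) + q ^ j * exp (\<theta> * w))) \<longlonglongrightarrow> min b (1 / (1 - q))"
        by simp
      show "AE w in \<mu>. norm (min b ((\<Sum>i<j. q ^ i) + q ^ j * exp (\<theta> * w))) \<le> b" for j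
        using that q by (auto simp: sum_nonneg min_def intro!: add_nonneg_nonneg)
    qed auto
    then have "(\<integral>w. min b (exp (\<theta> * w)) \<partial>\<mu>) \<le> (\<integral>w. min b (1 / (1 - q)) \<partial>\<mu>)"
      using iterate[OF that] by (intro LIMSEQ_le_const) auto
    then show ?thesis
      by (simp add: M1.prob_space)
  qed
  have int_min: "integrable \<mu> (\<lambda>w. min (real i) (exp (\<theta> * w)))" for i
    by (intro M1.integrable_const_bound[where B = "real i"]) auto
  \<comment> \<open>Monotone convergence removes the truncation: along integer levels the integrals
    increase and stay below \<open>1 / (1 - q)\<close>.\<close>
  have "incseq (\<lambda>i. \<integral>w. min (real i) (exp (\<theta> * w)) \<partial>\<mu>)"
    by (intro incseq_SucI integral_mono int_min) auto
  then obtain l where l: "(\<lambda>i. \<integral>w. min (real i) (exp (\<theta> * w)) \<partial>\<mu>) \<longlonglongrightarrow> l"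
    by (rule incseq_convergent[where B = "1 / (1 - q)"]) (simp add: bound)
  show ?thesis
  proof (rule integrable_monotone_convergence[OF int_min _ _ l])
    show "AE w in \<mu>. mono (\<lambda>i. min (real i) (exp (\<theta> * w)))"
      by (auto simp: mono_def)
    have "(\<lambda>i. min (real i) x) \<longlonglongrightarrow> x" for x
    proof (rule tendsto_eventually)
      show "\<forall>\<^sub>F i in sequentially. min (real i) x = x"
        using eventually_ge_at_top[of "nat \<lceil>x\<rceil>"]
        by eventually_elim (simp add: min_absorb2 ceiling_le_iff nat_le_iff)
    qed
    then show "AE w in \<mu>. (\<lambda>i. min (real i) (exp (\<theta> * w))) \<longlonglongrightarrow> exp (\<theta> * w)"
      by simp
  qed simp
qed

section \<open>Moments in equilibrium under exponential increments and negative drift\<close>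

context
  fixes s :: real
  assumes s_pos: "0 < s" and int_exp: "integrable N (\<lambda>z. exp (s * \<bar>X z\<bar>))"
    and negative_drift: "(\<integral>z. X z \<partial>N) < 0"
begin

text \<open>Negative drift provides a rate \<open>\<theta>\<close> with transform below 1, hence an
  exponential moment of the equilibrium, which dominates every power.\<close>

lemma integrable_power_equilibrium: "integrable \<mu> (\<lambda>w. w ^ k)"
proof -
  obtain \<theta> where \<theta>: "0 < \<theta>" "integrable N (\<lambda>z. exp (\<theta> * X z))" "(\<integral>z. exp (\<theta> * X z) \<partial>N) < 1"
    using M2.exp_moment_less_1[OF measurable_increment s_pos int_exp negative_drift] by blast
  show ?thesis
  proof (rule Bochner_Integration.integrable_bound)
    show "integrable \<mu> (\<lambda>w. fact k / \<theta> ^ k * exp (\<theta> * w))"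
      using integrable_exp_equilibrium[OF \<theta>] by simp
    show "AE w in \<mu>. norm (w ^ k) \<le> norm (fact k / \<theta> ^ k * exp (\<theta> * w))"
      using equilibrium_nonneg
    proof eventually_elim
      case (elim w)
      then show ?case
        using power_le_fact_mult_exp_scaled[of w \<theta> k] \<theta>(1) by simp
    qed
  qed simp
qed

text \<open>With \<open>s\<close> proportional to the square root of the sample size and a bounded
  exponential moment, the factor \<open>1 / s ^ j\<close> yields the scaling \<open>n\<close> to the
  power \<open>- j / 2\<close>.\<close>

lemma
  shows integrable_abs_power_increment: "integrable N (\<lambda>z. \<bar>X z\<bar> ^ j)"
    and abs_moment_increment_le: "(\<integral>z. \<bar>X z\<bar> ^ j \<partial>N) \<le> fact j / s ^ j * (\<integral>z. exp (s * \<bar>X z\<bar>) \<partial>N)"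
proof -
  have bound: "\<bar>x\<bar> ^ j \<le> fact j / s ^ j * exp (s * \<bar>x\<bar>)" for x
    using s_pos by (intro power_le_fact_mult_exp_scaled) auto
  show *: "integrable N (\<lambda>z. \<bar>X z\<bar> ^ j)"
    by (rule Bochner_Integration.integrable_bound[where f = "\<lambda>z. fact j / s ^ j * exp (s * \<bar>X z\<bar>)"])
      (use int_exp bound s_pos in auto)
  have "(\<integral>z. \<bar>X z\<bar> ^ j \<partial>N) \<le> (\<integral>z. fact j / s ^ j * exp (s * \<bar>X z\<bar>) \<partial>N)"
    using int_exp by (intro integral_mono * bound) auto
  then show "(\<integral>z. \<bar>X z\<bar> ^ j \<partial>N) \<le> fact j / s ^ j * (\<integral>z. exp (s * \<bar>X z\<bar>) \<partial>N)"
    by simp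
qed

lemma integrable_power_increment: "integrable N (\<lambda>z. X z ^ j)"
  by (rule Bochner_Integration.integrable_bound[OF integrable_abs_power_increment[of j]])
    (auto simp: power_abs)

text \<open>In the binomial expansion of the moment of \<open>w + X z\<close>, the term
  \<open>j = 0\<close> is the top moment of the equilibrium. By stationarity it equals the moment of
  the positive part and cancels, so the sum starts at 1 and the highest moment left, of order
  \<open>k\<close>, is multiplied by the mean increment.\<close>

lemma
  shows integrable_idle_power: "integrable (\<mu> \<Otimes>\<^sub>M N) (\<lambda>(w, z). max 0 (- (w + X z)) ^ Suc k)"
    and moment_identity:
      "(\<Sum>j = 1..Suc k. real (Suc k choose j) * (\<integral>w. w ^ (Suc k - j) \<partial>\<mu>) * (\<integral>z. X z ^ j \<partial>N))
        = (- 1) ^ Suc k * integral\<^sup>L (\<mu> \<Otimes>\<^sub>M N) (\<lambda>(w, z). max 0 (- (w + X z)) ^ Suc k)"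
proof -
  let ?e = "Suc k"
  have expand: "(\<lambda>(w, z). (w + X z) ^ ?e)
      = (\<lambda>p. \<Sum>j\<le>?e. case p of (w, z) \<Rightarrow> (real (?e choose j) * w ^ (?e - j)) * X z ^ j)"
    using binomial_ring[of "X _" _ ?e] by (auto simp: fun_eq_iff add.commute mult_ac simp del: power_Suc sum.atMost_Suc)
  have int_term: "integrable (\<mu> \<Otimes>\<^sub>M N) (\<lambda>(w, z). (real (?e choose j) * w ^ (?e - j)) * X z ^ j)" for j
    by (intro integrable_mult_fst_snd integrable_power_increment integrable_mult_right integrable_power_equilibrium)
  have int_sum: "integrable (\<mu> \<Otimes>\<^sub>M N) (\<lambda>(w, z). (w + X z) ^ ?e)"
    unfolding expand by (intro Bochner_Integration.integrable_sum int_term)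
  have "integral\<^sup>L (\<mu> \<Otimes>\<^sub>M N) (\<lambda>(w, z). (w + X z) ^ ?e)
      = (\<Sum>j\<le>?e. integral\<^sup>L (\<mu> \<Otimes>\<^sub>M N) (\<lambda>(w, z). (real (?e choose j) * w ^ (?e - j)) * X z ^ j))"
    unfolding expand by (intro Bochner_Integration.integral_sum int_term)
  also have "\<dots> = (\<Sum>j\<le>?e. real (?e choose j) * (\<integral>w. w ^ (?e - j) \<partial>\<mu>) * (\<integral>z. X z ^ j \<partial>N))"
    by (intro sum.cong refl, subst integral_mult_fst_snd)
      (auto intro!: integrable_power_increment integrable_mult_right integrable_power_equilibrium)
  also have "\<dots> = (\<integral>w. w ^ ?e \<partial>\<mu>)
      + (\<Sum>j = 1..?e. real (?e choose j) * (\<integral>w. w ^ (?e - j) \<partial>\<mu>) * (\<integral>z. X z ^ j \<partial>N))"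
    by (simp add: atMost_atLeast0 sum.atLeast_Suc_atMost M2.prob_space del: sum.cl_ivl_Suc power_Suc binomial_Suc_Suc)
  finally have total: "integral\<^sup>L (\<mu> \<Otimes>\<^sub>M N) (\<lambda>(w, z). (w + X z) ^ ?e) = \<dots>" .
  have int_max: "integrable (\<mu> \<Otimes>\<^sub>M N) (\<lambda>(w, z). max 0 (w + X z) ^ ?e)"
    by (intro integrable_stationary integrable_power_equilibrium) simp
  \<comment> \<open>The positive exponent matters: with \<open>0 ^ 0 = 1\<close> this decomposition
    fails at exponent 0.\<close>
  have split: "max 0 (- y) ^ ?e = (- 1) ^ ?e * (y ^ ?e - max 0 y ^ ?e)" for y :: real
    by (cases "0 \<le> y") (auto simp: max_def power_minus[of y] simp del: power_Suc)
  have idle: "(\<lambda>(w, z). max 0 (- (w + X z)) ^ ?e)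
      = (\<lambda>p. (- 1) ^ ?e * ((case p of (w, z) \<Rightarrow> (w + X z) ^ ?e) - (case p of (w, z) \<Rightarrow> max 0 (w + X z) ^ ?e)))"
    by (auto simp only: fun_eq_iff split split: prod.split)
  show "integrable (\<mu> \<Otimes>\<^sub>M N) (\<lambda>(w, z). max 0 (- (w + X z)) ^ ?e)"
    unfolding idle by (intro integrable_mult_right Bochner_Integration.integrable_diff int_sum int_max)
  have "integral\<^sup>L (\<mu> \<Otimes>\<^sub>M N) (\<lambda>(w, z). max 0 (- (w + X z)) ^ ?e) = (- 1) ^ ?e *
      (integral\<^sup>L (\<mu> \<Otimes>\<^sub>M N) (\<lambda>(w, z). (w + X z) ^ ?e) - integral\<^sup>L (\<mu> \<Otimes>\<^sub>M N) (\<lambda>(w, z). max 0 (w + X z) ^ ?e))"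
    unfolding idle by (simp only: integral_mult_right_zero Bochner_Integration.integral_diff int_sum int_max)
  also have "integral\<^sup>L (\<mu> \<Otimes>\<^sub>M N) (\<lambda>(w, z). max 0 (w + X z) ^ ?e) = (\<integral>w. w ^ ?e \<partial>\<mu>)"
    by (rule integral_stationary[symmetric]) simp
  finally show "(\<Sum>j = 1..?e. real (?e choose j) * (\<integral>w. w ^ (?e - j) \<partial>\<mu>) * (\<integral>z. X z ^ j \<partial>N))
        = (- 1) ^ ?e * integral\<^sup>L (\<mu> \<Otimes>\<^sub>M N) (\<lambda>(w, z). max 0 (- (w + X z)) ^ ?e)"
    unfolding total by (simp add: mult.assoc[symmetric] del: power_Suc sum.cl_ivl_Suc binomial_Suc_Suc flip: power_mult_distrib)
qed

text \<open>Where the negative part is at most \<open>a\<close>, all but one of its factors are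
  replaced by \<open>a\<close>, and the first moment left over is minus the drift. Where it exceeds
  \<open>a\<close>, nonnegativity of \<open>w\<close> forces \<open>\<bar>x\<bar> \<ge> a\<close>,
  and the exponential moment controls the tail.\<close>

lemma idle_moment_le:
  assumes "0 \<le> a"
  shows "integral\<^sup>L (\<mu> \<Otimes>\<^sub>M N) (\<lambda>(w, z). max 0 (- (w + X z)) ^ Suc k)
    \<le> a ^ k * - (\<integral>z. X z \<partial>N)
      + fact (Suc k) / (s / 2) ^ Suc k * exp (- (s * a / 2)) * (\<integral>z. exp (s * \<bar>X z\<bar>) \<partial>N)"
proof -
  let ?C = "fact (Suc k) / (s / 2) ^ Suc k * exp (- (s * a / 2))"
  \<comment> \<open>The case \<open>k = 0\<close> of the identity: the mean of the negative part
    balances the drift exactly.\<close>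
  have first: "integral\<^sup>L (\<mu> \<Otimes>\<^sub>M N) (\<lambda>(w, z). max 0 (- (w + X z))) = - (\<integral>z. X z \<partial>N)"
    using moment_identity[of 0] by (simp add: M1.prob_space)
  have int_first: "integrable (\<mu> \<Otimes>\<^sub>M N) (\<lambda>(w, z). max 0 (- (w + X z)))"
    using integrable_idle_power[of 0] by simp
  have int_tail: "integrable (\<mu> \<Otimes>\<^sub>M N) (\<lambda>(w, z). exp (s * \<bar>X z\<bar>))"
    and tail: "integral\<^sup>L (\<mu> \<Otimes>\<^sub>M N) (\<lambda>(w, z). exp (s * \<bar>X z\<bar>)) = (\<integral>z. exp (s * \<bar>X z\<bar>) \<partial>N)"
    using integrable_mult_fst_snd[of "\<lambda>_. 1" "\<lambda>z. exp (s * \<bar>X z\<bar>)"]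
      integral_mult_fst_snd[of "\<lambda>_. 1" "\<lambda>z. exp (s * \<bar>X z\<bar>)"] int_exp by (auto simp: M1.prob_space)
  have bound: "max 0 (- (w + x)) ^ Suc k \<le> a ^ k * max 0 (- (w + x)) + ?C * exp (s * \<bar>x\<bar>)" if "0 \<le> w" for w x :: real
  proof (cases "max 0 (- (w + x)) \<le> a")
    case True
    then have "max 0 (- (w + x)) ^ k * max 0 (- (w + x)) \<le> a ^ k * max 0 (- (w + x))"
      by (intro mult_right_mono power_mono) auto
    moreover have "0 \<le> ?C * exp (s * \<bar>x\<bar>)"
      using s_pos by simp
    ultimately show ?thesis
      unfolding power_Suc2 by linarith
  next
    case False
    then have x: "a \<le> \<bar>x\<bar>" "max 0 (- (w + x)) \<le> \<bar>x\<bar>"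
      using that by auto
    have "max 0 (- (w + x)) ^ Suc k \<le> \<bar>x\<bar> ^ Suc k"
      using x by (intro power_mono) auto
    also have "\<dots> \<le> fact (Suc k) / (s / 2) ^ Suc k * exp (s / 2 * \<bar>x\<bar>)"
      using s_pos by (intro power_le_fact_mult_exp_scaled) auto
    \<comment> \<open>Since \<open>a \<le> \<bar>x\<bar>\<close>, half of the rate \<open>s\<close>
      can be traded for the small factor \<open>exp (- (s * a / 2))\<close>.\<close>
    also have "\<dots> \<le> fact (Suc k) / (s / 2) ^ Suc k * exp (- (s * a / 2) + s * \<bar>x\<bar>)"
      using s_pos x(1) by (intro mult_left_mono) auto
    also have "\<dots> = ?C * exp (s * \<bar>x\<bar>)"
      by (simp only: exp_add mult.assoc)
    also have "\<dots> \<le> a ^ k * max 0 (- (w + x)) + ?C * exp (s * \<bar>x\<bar>)"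
      using assms by simp
    finally show ?thesis .
  qed
  have "AE p in \<mu> \<Otimes>\<^sub>M N. 0 \<le> fst p"
    using equilibrium_nonneg by (intro AE_pair_measure) auto
  then have "AE p in \<mu> \<Otimes>\<^sub>M N. (case p of (w, z) \<Rightarrow> max 0 (- (w + X z)) ^ Suc k)
      \<le> a ^ k * (case p of (w, z) \<Rightarrow> max 0 (- (w + X z))) + ?C * (case p of (w, z) \<Rightarrow> exp (s * \<bar>X z\<bar>))"
    by eventually_elim (auto simp only: split_beta intro!: bound)
  then have "integral\<^sup>L (\<mu> \<Otimes>\<^sub>M N) (\<lambda>(w, z). max 0 (- (w + X z)) ^ Suc k)
      \<le> (\<integral>p. a ^ k * (case p of (w, z) \<Rightarrow> max 0 (- (w + X z))) + ?C * (case p of (w, z) \<Rightarrow> exp (s * \<bar>X z\<bar>)) \<partial>(\<mu> \<Otimes>\<^sub>M N))"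
    by (intro integral_mono_AE integrable_idle_power Bochner_Integration.integrable_add integrable_mult_right int_first int_tail)
  also have "\<dots> = a ^ k * - (\<integral>z. X z \<partial>N) + ?C * (\<integral>z. exp (s * \<bar>X z\<bar>) \<partial>N)"
    by (subst Bochner_Integration.integral_add)
      (simp_all only: integral_mult_right_zero first tail integrable_mult_right int_first int_tail)
  finally show ?thesis .
qed

end

end

section \<open>Means of i.i.d. samples\<close>

context prob_space
begin

context
  fixes Y :: "'i \<Rightarrow> 'a \<Rightarrow> real" and Z :: "'a \<Rightarrow> real" and I :: "'i set"
  assumes indep: "indep_vars (\<lambda>_. borel) Y I" and fin: "finite I"
    and ident: "\<And>i. i \<in> I \<Longrightarrow> distr M borel (Y i) = distr M borel Z"
    and measurable_Z [measurable]: "Z \<in> borel_measurable M"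
begin

lemma measurable_iid: "i \<in> I \<Longrightarrow> Y i \<in> borel_measurable M"
  using indep unfolding indep_vars_def by auto

lemma
  fixes h :: "real \<Rightarrow> real"
  assumes "i \<in> I" and [measurable]: "h \<in> borel_measurable borel"
  shows integrable_iid_iff: "integrable M (\<lambda>x. h (Y i x)) \<longleftrightarrow> integrable M (\<lambda>x. h (Z x))"
    and expectation_iid: "expectation (\<lambda>x. h (Y i x)) = expectation (\<lambda>x. h (Z x))"
proof -
  note [measurable] = measurable_iid[OF \<open>i \<in> I\<close>]
  show "integrable M (\<lambda>x. h (Y i x)) \<longleftrightarrow> integrable M (\<lambda>x. h (Z x))"
    using integrable_distr_eq[of "Y i" M borel h] integrable_distr_eq[of Z M borel h] ident[OF \<open>i \<in> I\<close>] by simp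
  show "expectation (\<lambda>x. h (Y i x)) = expectation (\<lambda>x. h (Z x))"
    using integral_distr[of "Y i" M borel h] integral_distr[of Z M borel h] ident[OF \<open>i \<in> I\<close>] by simp
qed

lemma
  assumes int: "integrable M (\<lambda>x. exp (s * Z x))"
  shows integrable_exp_iid_sum: "integrable M (\<lambda>x. exp (s * (\<Sum>i\<in>I. Y i x)))"
    and expectation_exp_iid_sum:
      "expectation (\<lambda>x. exp (s * (\<Sum>i\<in>I. Y i x))) = expectation (\<lambda>x. exp (s * Z x)) ^ card I"
proof -
  have indep_exp: "indep_vars (\<lambda>_. borel) (\<lambda>i x. exp (s * Y i x)) I"
    by (rule indep_vars_compose2[OF indep]) auto
  have int_exp: "integrable M (\<lambda>x. exp (s * Y i x))" if "i \<in> I" for i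
    using integrable_iid_iff[OF that, of "\<lambda>y. exp (s * y)"] int by simp
  have exp_sum: "exp (s * (\<Sum>i\<in>I. Y i x)) = (\<Prod>i\<in>I. exp (s * Y i x))" for x
    using fin by (simp add: sum_distrib_left exp_sum)
  show "integrable M (\<lambda>x. exp (s * (\<Sum>i\<in>I. Y i x)))"
    unfolding exp_sum by (rule indep_vars_integrable[OF fin indep_exp int_exp])
  have "expectation (\<lambda>x. exp (s * (\<Sum>i\<in>I. Y i x))) = (\<Prod>i\<in>I. expectation (\<lambda>x. exp (s * Y i x)))"
    unfolding exp_sum by (rule indep_vars_lebesgue_integral[OF fin indep_exp int_exp])
  also have "\<dots> = (\<Prod>i\<in>I. expectation (\<lambda>x. exp (s * Z x)))"
    by (intro prod.cong refl expectation_iid[where h = "\<lambda>y. exp (s * y)"]) auto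
  finally show "expectation (\<lambda>x. exp (s * (\<Sum>i\<in>I. Y i x))) = expectation (\<lambda>x. exp (s * Z x)) ^ card I"
    by simp
qed

text \<open>The cross term between one variable and the sum of the others factorises by
  independence. The induction runs over subsets \<open>J\<close> of \<open>I\<close>, since
  independence passes to subfamilies.\<close>

lemma
  assumes int: "integrable M Z" and int_sq: "integrable M (\<lambda>x. (Z x)\<^sup>2)"
  shows integrable_iid_sum: "integrable M (\<lambda>x. \<Sum>i\<in>I. Y i x)"
    and expectation_iid_sum: "expectation (\<lambda>x. \<Sum>i\<in>I. Y i x) = card I * expectation Z"
    and integrable_iid_sum_square: "integrable M (\<lambda>x. (\<Sum>i\<in>I. Y i x)\<^sup>2)"
    and expectation_iid_sum_square: "expectation (\<lambda>x. (\<Sum>i\<in>I. Y i x)\<^sup>2)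
      = card I * variance Z + (card I * expectation Z)\<^sup>2"
proof -
  have intY: "integrable M (Y i)" and EY: "expectation (Y i) = expectation Z"
    and intY_sq: "integrable M (\<lambda>x. (Y i x)\<^sup>2)"
    and EY_sq: "expectation (\<lambda>x. (Y i x)\<^sup>2) = variance Z + (expectation Z)\<^sup>2" if "i \<in> I" for i
    using integrable_iid_iff[OF that, of "\<lambda>y. y"] expectation_iid[OF that, of "\<lambda>y. y"]
      integrable_iid_iff[OF that, of "\<lambda>y. y\<^sup>2"] expectation_iid[OF that, of "\<lambda>y. y\<^sup>2"]
      variance_eq[OF int int_sq] int int_sq by simp_all
  have "integrable M (\<lambda>x. \<Sum>i\<in>J. Y i x) \<and> expectation (\<lambda>x. \<Sum>i\<in>J. Y i x) = card J * expectation Z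
      \<and> integrable M (\<lambda>x. (\<Sum>i\<in>J. Y i x)\<^sup>2)
      \<and> expectation (\<lambda>x. (\<Sum>i\<in>J. Y i x)\<^sup>2) = card J * variance Z + (card J * expectation Z)\<^sup>2"
    if "J \<subseteq> I" for J
    using finite_subset[OF that fin] that
  proof (induction J rule: finite_induct)
    case (insert i J)
    let ?S = "\<lambda>x. \<Sum>i\<in>J. Y i x"
    have S: "integrable M ?S" "expectation ?S = card J * expectation Z" "integrable M (\<lambda>x. (?S x)\<^sup>2)"
      "expectation (\<lambda>x. (?S x)\<^sup>2) = card J * variance Z + (card J * expectation Z)\<^sup>2" and "i \<in> I"
      using insert by auto
    have "indep_var borel (Y i) borel ?S"
      using insert.prems insert.hyps by (intro indep_vars_sum indep_vars_subset[OF indep]) auto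
    note prod = indep_var_lebesgue_integral[OF this intY[OF \<open>i \<in> I\<close>] S(1)]
      indep_var_integrable[OF this intY[OF \<open>i \<in> I\<close>] S(1)]
    have sum: "(\<Sum>i\<in>insert i J. Y i x) = Y i x + ?S x" for x
      using insert.hyps by simp
    have sq: "(\<Sum>i\<in>insert i J. Y i x)\<^sup>2 = (Y i x)\<^sup>2 + 2 * (Y i x * ?S x) + (?S x)\<^sup>2" for x
      unfolding sum by (simp add: power2_sum algebra_simps)
    show ?case
      unfolding sq unfolding sum
      using S intY[OF \<open>i \<in> I\<close>] EY[OF \<open>i \<in> I\<close>] intY_sq[OF \<open>i \<in> I\<close>] EY_sq[OF \<open>i \<in> I\<close>] prod insert.hyps
      by (simp add: algebra_simps power2_eq_square)
  qed (simp_all add: prob_space)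
  from this[OF order_refl]
  show "integrable M (\<lambda>x. \<Sum>i\<in>I. Y i x)" "expectation (\<lambda>x. \<Sum>i\<in>I. Y i x) = card I * expectation Z"
    "integrable M (\<lambda>x. (\<Sum>i\<in>I. Y i x)\<^sup>2)"
    "expectation (\<lambda>x. (\<Sum>i\<in>I. Y i x)\<^sup>2) = card I * variance Z + (card I * expectation Z)\<^sup>2"
    by auto
qed

text \<open>Stated for the law \<open>D\<close> of the mean, because the stationarity equation of
  the queue involves only marginal laws.\<close>

lemma
  fixes D :: "real measure"
  defines "D \<equiv> distr M borel (\<lambda>x. 1 / card I * (\<Sum>i\<in>I. Y i x))"
  assumes nonempty: "I \<noteq> {}" and int: "integrable M Z" and int_sq: "integrable M (\<lambda>x. (Z x)\<^sup>2)"
  shows prob_space_iid_mean: "prob_space D"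
    and integrable_iid_mean: "integrable D (\<lambda>x. x)"
    and expectation_iid_mean: "(\<integral>x. x \<partial>D) = expectation Z"
    and integrable_iid_mean_square: "integrable D (\<lambda>x. x\<^sup>2)"
    and expectation_iid_mean_square: "(\<integral>x. x\<^sup>2 \<partial>D) = variance Z / card I + (expectation Z)\<^sup>2"
    and integrable_exp_iid_mean: "integrable M (\<lambda>x. exp (t / card I * Z x)) \<Longrightarrow> integrable D (\<lambda>x. exp (t * x))"
    and expectation_exp_iid_mean: "integrable M (\<lambda>x. exp (t / card I * Z x)) \<Longrightarrow>
      (\<integral>x. exp (t * x) \<partial>D) = expectation (\<lambda>x. exp (t / card I * Z x)) ^ card I"
proof -
  have card: "real (card I) \<noteq> 0"
    using fin nonempty by simp
  have meas [measurable]: "(\<lambda>x. \<Sum>i\<in>I. Y i x) \<in> borel_measurable M"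
    using measurable_iid by simp
  show "prob_space D"
    unfolding D_def by (intro prob_space_distr) measurable
  show "integrable D (\<lambda>x. x)"
    using integrable_iid_sum[OF int int_sq] by (simp add: D_def integrable_distr_eq)
  show "(\<integral>x. x \<partial>D) = expectation Z"
    using expectation_iid_sum[OF int int_sq] card by (simp add: D_def integral_distr)
  show "integrable D (\<lambda>x. x\<^sup>2)"
    using integrable_iid_sum_square[OF int int_sq]
    by (simp add: D_def integrable_distr_eq power_divide)
  show "(\<integral>x. x\<^sup>2 \<partial>D) = variance Z / card I + (expectation Z)\<^sup>2"
    using expectation_iid_sum_square[OF int int_sq] card
    by (simp add: D_def integral_distr power_divide) (simp add: field_simps power2_eq_square)
  assume int_exp: "integrable M (\<lambda>x. exp (t / card I * Z x))"
  show "integrable D (\<lambda>x. exp (t * x))"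
    using integrable_exp_iid_sum[OF int_exp] by (simp add: D_def integrable_distr_eq)
  show "(\<integral>x. exp (t * x) \<partial>D) = expectation (\<lambda>x. exp (t / card I * Z x)) ^ card I"
    using expectation_exp_iid_sum[OF int_exp] by (simp add: D_def integral_distr)
qed

text \<open>The transform of the mean at \<open>t\<close> is a power of the transform of
  \<open>Z\<close> at \<open>t / card I\<close>; \<open>1 + u \<le> exp u\<close> turns the
  quadratic bound into an exponential one. For \<open>t\<close> of the order of the square root of
  \<open>card I\<close> the quadratic term stays bounded.\<close>

lemma
  fixes D :: "real measure"
  defines "D \<equiv> distr M borel (\<lambda>x. 1 / card I * (\<Sum>i\<in>I. Y i x))"
  assumes nonempty: "I \<noteq> {}" and int: "integrable M Z" and int_sq: "integrable M (\<lambda>x. (Z x)\<^sup>2)"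
    and int_exp: "\<And>s. \<bar>s\<bar> \<le> \<eta> \<Longrightarrow> integrable M (\<lambda>x. exp (s * Z x))"
    and exp_le: "\<And>s. \<bar>s\<bar> \<le> \<eta> \<Longrightarrow> expectation (\<lambda>x. exp (s * Z x)) \<le> 1 + s * expectation Z + s\<^sup>2 * K"
    and t: "\<bar>t\<bar> / card I \<le> \<eta>"
  shows integrable_exp_iid_mean': "integrable D (\<lambda>x. exp (t * x))"
    and expectation_exp_iid_mean_le: "(\<integral>x. exp (t * x) \<partial>D) \<le> exp (t * expectation Z + t\<^sup>2 * K / card I)"
proof -
  have card: "real (card I) \<noteq> 0"
    using fin nonempty by simp
  let ?s = "t / card I"
  have s: "\<bar>?s\<bar> \<le> \<eta>"
    using t by simp
  show "integrable D (\<lambda>x. exp (t * x))"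
    unfolding D_def by (rule integrable_exp_iid_mean[OF nonempty int int_sq int_exp[OF s]])
  have le: "expectation (\<lambda>x. exp (?s * Z x)) \<le> exp (?s * expectation Z + ?s\<^sup>2 * K)"
    using exp_le[OF s] exp_ge_add_one_self[of "?s * expectation Z + ?s\<^sup>2 * K"] by linarith
  have "(\<integral>x. exp (t * x) \<partial>D) = expectation (\<lambda>x. exp (?s * Z x)) ^ card I"
    unfolding D_def by (rule expectation_exp_iid_mean[OF nonempty int int_sq int_exp[OF s]])
  also have "\<dots> \<le> exp (?s * expectation Z + ?s\<^sup>2 * K) ^ card I"
    by (intro power_mono le) simp
  also have "\<dots> = exp (t * expectation Z + t\<^sup>2 * K / card I)"
    using card by (simp add: power2_eq_square field_simps flip: exp_of_nat_mult)
  finally show "(\<integral>x. exp (t * x) \<partial>D) \<le> exp (t * expectation Z + t\<^sup>2 * K / card I)" .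
qed

end

end

section \<open>Difference of two independent variables on a product space\<close>

lemma (in pair_prob_space)
  fixes f :: "'a \<Rightarrow> real" and g :: "'b \<Rightarrow> real"
  assumes f: "integrable M1 f" "integrable M1 (\<lambda>x. (f x)\<^sup>2)"
    and g: "integrable M2 g" "integrable M2 (\<lambda>y. (g y)\<^sup>2)"
  shows expectation_diff_fst_snd:
      "integral\<^sup>L (M1 \<Otimes>\<^sub>M M2) (\<lambda>(x, y). f x - g y) = (\<integral>x. f x \<partial>M1) - (\<integral>y. g y \<partial>M2)"
    and expectation_diff_fst_snd_square:
      "integral\<^sup>L (M1 \<Otimes>\<^sub>M M2) (\<lambda>(x, y). (f x - g y)\<^sup>2)
        = (\<integral>x. (f x)\<^sup>2 \<partial>M1) - 2 * (\<integral>x. f x \<partial>M1) * (\<integral>y. g y \<partial>M2) + (\<integral>y. (g y)\<^sup>2 \<partial>M2)"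
proof -
  have one: "integrable M1 (\<lambda>_. 1 :: real)" "integrable M2 (\<lambda>_. 1 :: real)"
    by auto
  note prod = integral_mult_fst_snd integrable_mult_fst_snd
  show "integral\<^sup>L (M1 \<Otimes>\<^sub>M M2) (\<lambda>(x, y). f x - g y) = (\<integral>x. f x \<partial>M1) - (\<integral>y. g y \<partial>M2)"
    using prod[OF f(1) one(2)] prod[OF one(1) g(1)]
    by (simp add: case_prod_unfold M1.prob_space M2.prob_space)
  have "(\<lambda>(x, y). (f x - g y)\<^sup>2) = (\<lambda>(x, y). (f x)\<^sup>2 - 2 * (f x * g y) + (g y)\<^sup>2)"
    by (auto simp: power2_diff)
  then show "integral\<^sup>L (M1 \<Otimes>\<^sub>M M2) (\<lambda>(x, y). (f x - g y)\<^sup>2)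
        = (\<integral>x. (f x)\<^sup>2 \<partial>M1) - 2 * (\<integral>x. f x \<partial>M1) * (\<integral>y. g y \<partial>M2) + (\<integral>y. (g y)\<^sup>2 \<partial>M2)"
    using prod[OF f(2) one(2)] prod[OF one(1) g(2)] prod[OF f(1) g(1)]
    by (simp add: case_prod_unfold M1.prob_space M2.prob_space)
qed

text \<open>\<open>exp (s * \<bar>d\<bar>)\<close> is at most
  \<open>exp (s * d) + exp (- s * d)\<close>, and each summand factorises over the product
  measure.\<close>

lemma (in pair_prob_space)
  fixes f :: "'a \<Rightarrow> real" and g :: "'b \<Rightarrow> real"
  assumes [measurable]: "f \<in> borel_measurable M1" "g \<in> borel_measurable M2"
    and f: "integrable M1 (\<lambda>x. exp (s * f x))" "integrable M1 (\<lambda>x. exp (- s * f x))"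
    and g: "integrable M2 (\<lambda>y. exp (s * g y))" "integrable M2 (\<lambda>y. exp (- s * g y))"
  shows integrable_exp_abs_diff_fst_snd: "integrable (M1 \<Otimes>\<^sub>M M2) (\<lambda>(x, y). exp (s * \<bar>f x - g y\<bar>))"
    and expectation_exp_abs_diff_fst_snd_le:
      "integral\<^sup>L (M1 \<Otimes>\<^sub>M M2) (\<lambda>(x, y). exp (s * \<bar>f x - g y\<bar>))
        \<le> (\<integral>x. exp (s * f x) \<partial>M1) * (\<integral>y. exp (- s * g y) \<partial>M2)
          + (\<integral>x. exp (- s * f x) \<partial>M1) * (\<integral>y. exp (s * g y) \<partial>M2)"
proof -
  let ?h = "\<lambda>p. (case p of (x, y) \<Rightarrow> exp (s * f x) * exp (- s * g y)) + (case p of (x, y) \<Rightarrow> exp (- s * f x) * exp (s * g y))"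
  have int_h: "integrable (M1 \<Otimes>\<^sub>M M2) ?h"
    using f g by (intro Bochner_Integration.integrable_add integrable_mult_fst_snd)
  have bound: "(case p of (x, y) \<Rightarrow> exp (s * \<bar>f x - g y\<bar>)) \<le> ?h p" for p
    by (cases p) (auto simp: abs_real_def algebra_simps simp flip: exp_add)
  show int: "integrable (M1 \<Otimes>\<^sub>M M2) (\<lambda>(x, y). exp (s * \<bar>f x - g y\<bar>))"
  proof (rule Bochner_Integration.integrable_bound[OF int_h])
    show "AE p in M1 \<Otimes>\<^sub>M M2. norm (case p of (x, y) \<Rightarrow> exp (s * \<bar>f x - g y\<bar>)) \<le> norm (?h p)"
    proof (rule AE_I2)
      fix p
      show "norm (case p of (x, y) \<Rightarrow> exp (s * \<bar>f x - g y\<bar>)) \<le> norm (?h p)"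
        using bound[of p] by (cases p) simp
    qed
  qed measurable
  have "integral\<^sup>L (M1 \<Otimes>\<^sub>M M2) (\<lambda>(x, y). exp (s * \<bar>f x - g y\<bar>)) \<le> integral\<^sup>L (M1 \<Otimes>\<^sub>M M2) ?h"
    by (intro integral_mono int int_h bound)
  also have "\<dots> = (\<integral>x. exp (s * f x) \<partial>M1) * (\<integral>y. exp (- s * g y) \<partial>M2)
          + (\<integral>x. exp (- s * f x) \<partial>M1) * (\<integral>y. exp (s * g y) \<partial>M2)"
    using integral_mult_fst_snd[OF f(1) g(2)] integral_mult_fst_snd[OF f(2) g(1)]
      integrable_mult_fst_snd[OF f(1) g(2)] integrable_mult_fst_snd[OF f(2) g(1)]
    by (subst Bochner_Integration.integral_add) auto
  finally show "integral\<^sup>L (M1 \<Otimes>\<^sub>M M2) (\<lambda>(x, y). exp (s * \<bar>f x - g y\<bar>))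
        \<le> (\<integral>x. exp (s * f x) \<partial>M1) * (\<integral>y. exp (- s * g y) \<partial>M2)
          + (\<integral>x. exp (- s * f x) \<partial>M1) * (\<integral>y. exp (s * g y) \<partial>M2)" .
qed

section \<open>The nearly deterministic queue\<close>

text \<open>The real points \<open>\<delta>\<close> and \<open>- \<delta>\<close> lie inside the
  strip, and there the norm of the complex exponential is the real one.\<close>

lemma integrable_exp_abs_of_mgf:
  assumes [measurable]: "Z \<in> borel_measurable M" and "0 < \<delta>" and mgf: "mgf_analytic_beyond_strip M Z \<delta>"
  shows "integrable M (\<lambda>x. exp (\<delta> * \<bar>Z x\<bar>))"
proof -
  have "integrable M (\<lambda>x. exp (s * Z x))" if "s = \<delta> \<or> s = - \<delta>" for s
  proof -
    obtain a b where "a < - \<delta>" "\<delta> < b"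
      "\<And>z. a < Re z \<Longrightarrow> Re z < b \<Longrightarrow> integrable M (\<lambda>x. exp (z * complex_of_real (Z x)))"
      using mgf unfolding mgf_analytic_beyond_strip_def by blast
    moreover from this(1,2) have "a < Re (complex_of_real s)" "Re (complex_of_real s) < b"
      using that \<open>0 < \<delta>\<close> by auto
    ultimately have "integrable M (\<lambda>x. exp (complex_of_real s * complex_of_real (Z x)))"
      by blast
    from integrable_norm[OF this] show ?thesis
      by simp
  qed
  from this[of \<delta>] this[of "- \<delta>"]
  have int: "integrable M (\<lambda>x. exp (\<delta> * Z x) + exp (- \<delta> * Z x))"
    by simp
  have "norm (exp (\<delta> * \<bar>z\<bar>)) \<le> norm (exp (\<delta> * z) + exp (- \<delta> * z))" for z
    by (simp add: abs_of_pos[OF add_pos_pos]) (simp add: abs_real_def)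
  then show ?thesis
    by (intro Bochner_Integration.integrable_bound[OF int]) auto
qed

text \<open>The constants \<open>\<eta>\<close>, \<open>K\<^sub>V\<close>, \<open>K\<^sub>U\<close>
  are those of the quadratic transform bound for \<open>V\<close> and \<open>U\<close>. They are
  fixed before \<open>n\<close>, which is the source of all uniformity in \<open>n\<close>.\<close>

locale nearly_deterministic_queue = prob_space +
  fixes V U :: "'a \<Rightarrow> real" and VV UU :: "nat \<Rightarrow> nat \<Rightarrow> 'a \<Rightarrow> real" and \<eta> K\<^sub>V K\<^sub>U :: real
  assumes copies: "iid_copy_arrays M V U VV UU"
    and measurable_V [measurable]: "V \<in> borel_measurable M"
    and measurable_U [measurable]: "U \<in> borel_measurable M"
    and integrable_V: "integrable M V" and integrable_U: "integrable M U"
    and integrable_V_square: "integrable M (\<lambda>x. (V x)\<^sup>2)"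
    and integrable_U_square: "integrable M (\<lambda>x. (U x)\<^sup>2)"
    and expectation_V: "expectation V = 1" and expectation_U: "expectation U = 1"
    and integrable_exp_V: "\<bar>s\<bar> \<le> \<eta> \<Longrightarrow> integrable M (\<lambda>x. exp (s * V x))"
    and integrable_exp_U: "\<bar>s\<bar> \<le> \<eta> \<Longrightarrow> integrable M (\<lambda>x. exp (s * U x))"
    and exp_V_le: "\<bar>s\<bar> \<le> \<eta> \<Longrightarrow> expectation (\<lambda>x. exp (s * V x)) \<le> 1 + s * expectation V + s\<^sup>2 * K\<^sub>V"
    and exp_U_le: "\<bar>s\<bar> \<le> \<eta> \<Longrightarrow> expectation (\<lambda>x. exp (s * U x)) \<le> 1 + s * expectation U + s\<^sup>2 * K\<^sub>U"
begin

context
  fixes n :: nat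
  assumes n: "1 \<le> n"
begin

section \<open>Laws of the two row means\<close>

lemma
  shows indep_rows: "indep_vars (\<lambda>_. borel) (case_sum (VV n) (UU n)) ({1..n} <+> {1..n})"
    and distr_VV: "k \<in> {1..n} \<Longrightarrow> distr M borel (VV n k) = distr M borel V"
    and distr_UU: "k \<in> {1..n} \<Longrightarrow> distr M borel (UU n k) = distr M borel U"
  using copies n unfolding iid_copy_arrays_def by blast+

abbreviation (input) "D\<^sub>V \<equiv> distr M borel (row_mean VV n)"
abbreviation (input) "D\<^sub>U \<equiv> distr M borel (row_mean UU n)"

lemma
  shows prob_space_row_mean_V: "prob_space D\<^sub>V"
    and integrable_row_mean_V: "integrable D\<^sub>V (\<lambda>x. x)"
    and expectation_row_mean_V: "(\<integral>x. x \<partial>D\<^sub>V) = 1"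
    and integrable_row_mean_V_square: "integrable D\<^sub>V (\<lambda>x. x\<^sup>2)"
    and expectation_row_mean_V_square: "(\<integral>x. x\<^sup>2 \<partial>D\<^sub>V) = variance V / n + 1"
    and integrable_exp_row_mean_V: "\<bar>t\<bar> / n \<le> \<eta> \<Longrightarrow> integrable D\<^sub>V (\<lambda>x. exp (t * x))"
    and exp_row_mean_V_le: "\<bar>t\<bar> / n \<le> \<eta> \<Longrightarrow> (\<integral>x. exp (t * x) \<partial>D\<^sub>V) \<le> exp (t + t\<^sup>2 * K\<^sub>V / n)"
proof -
  \<comment> \<open>The left copy of \<open>{1..n}\<close> in the disjoint sum indexes the service
    row; a subfamily of the jointly independent family is independent.\<close>
  let ?I = "Inl ` {1..n} :: (nat + nat) set" and ?Y = "case_sum (VV n) (UU n)"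
  have indep: "indep_vars (\<lambda>_. borel) ?Y ?I"
    by (rule indep_vars_subset[OF indep_rows]) auto
  have ident: "distr M borel (?Y i) = distr M borel V" if "i \<in> ?I" for i
    using that distr_VV by auto
  have card: "card ?I = n" and fin: "finite ?I" and nonempty: "?I \<noteq> {}"
    using n by (auto simp: card_image)
  have mean: "row_mean VV n = (\<lambda>x. 1 / card ?I * (\<Sum>i\<in>?I. ?Y i x))"
    unfolding card by (rule ext) (simp add: row_mean_def sum.reindex)
  note iid = indep fin ident measurable_V nonempty integrable_V integrable_V_square
  show "prob_space D\<^sub>V"
    unfolding mean by (rule prob_space_iid_mean[OF iid])
  show "integrable D\<^sub>V (\<lambda>x. x)"
    unfolding mean by (rule integrable_iid_mean[OF iid])
  show "(\<integral>x. x \<partial>D\<^sub>V) = 1"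
    unfolding mean by (subst expectation_iid_mean[OF iid]) (simp_all only: expectation_V)
  show "integrable D\<^sub>V (\<lambda>x. x\<^sup>2)"
    unfolding mean by (rule integrable_iid_mean_square[OF iid])
  show "(\<integral>x. x\<^sup>2 \<partial>D\<^sub>V) = variance V / n + 1"
    unfolding mean by (subst expectation_iid_mean_square[OF iid]) (simp_all only: card expectation_V power_one)
  assume "\<bar>t\<bar> / n \<le> \<eta>"
  then have t: "\<bar>t\<bar> / card ?I \<le> \<eta>"
    by (simp only: card)
  show "integrable D\<^sub>V (\<lambda>x. exp (t * x))"
    unfolding mean by (rule integrable_exp_iid_mean'[OF iid integrable_exp_V exp_V_le t])
  show "(\<integral>x. exp (t * x) \<partial>D\<^sub>V) \<le> exp (t + t\<^sup>2 * K\<^sub>V / n)"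
    using expectation_exp_iid_mean_le[OF iid integrable_exp_V exp_V_le t]
    by (simp only: mean card expectation_V mult_1_right)
qed

lemma
  shows prob_space_row_mean_U: "prob_space D\<^sub>U"
    and integrable_row_mean_U: "integrable D\<^sub>U (\<lambda>x. x)"
    and expectation_row_mean_U: "(\<integral>x. x \<partial>D\<^sub>U) = 1"
    and integrable_row_mean_U_square: "integrable D\<^sub>U (\<lambda>x. x\<^sup>2)"
    and expectation_row_mean_U_square: "(\<integral>x. x\<^sup>2 \<partial>D\<^sub>U) = variance U / n + 1"
    and integrable_exp_row_mean_U: "\<bar>t\<bar> / n \<le> \<eta> \<Longrightarrow> integrable D\<^sub>U (\<lambda>x. exp (t * x))"
    and exp_row_mean_U_le: "\<bar>t\<bar> / n \<le> \<eta> \<Longrightarrow> (\<integral>x. exp (t * x) \<partial>D\<^sub>U) \<le> exp (t + t\<^sup>2 * K\<^sub>U / n)"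
proof -
  let ?I = "Inr ` {1..n} :: (nat + nat) set" and ?Y = "case_sum (VV n) (UU n)"
  have indep: "indep_vars (\<lambda>_. borel) ?Y ?I"
    by (rule indep_vars_subset[OF indep_rows]) auto
  have ident: "distr M borel (?Y i) = distr M borel U" if "i \<in> ?I" for i
    using that distr_UU by auto
  have card: "card ?I = n" and fin: "finite ?I" and nonempty: "?I \<noteq> {}"
    using n by (auto simp: card_image)
  have mean: "row_mean UU n = (\<lambda>x. 1 / card ?I * (\<Sum>i\<in>?I. ?Y i x))"
    unfolding card by (rule ext) (simp add: row_mean_def sum.reindex)
  note iid = indep fin ident measurable_U nonempty integrable_U integrable_U_square
  show "prob_space D\<^sub>U"
    unfolding mean by (rule prob_space_iid_mean[OF iid])
  show "integrable D\<^sub>U (\<lambda>x. x)"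
    unfolding mean by (rule integrable_iid_mean[OF iid])
  show "(\<integral>x. x \<partial>D\<^sub>U) = 1"
    unfolding mean by (subst expectation_iid_mean[OF iid]) (simp_all only: expectation_U)
  show "integrable D\<^sub>U (\<lambda>x. x\<^sup>2)"
    unfolding mean by (rule integrable_iid_mean_square[OF iid])
  show "(\<integral>x. x\<^sup>2 \<partial>D\<^sub>U) = variance U / n + 1"
    unfolding mean by (subst expectation_iid_mean_square[OF iid]) (simp_all only: card expectation_U power_one)
  assume "\<bar>t\<bar> / n \<le> \<eta>"
  then have t: "\<bar>t\<bar> / card ?I \<le> \<eta>"
    by (simp only: card)
  show "integrable D\<^sub>U (\<lambda>x. exp (t * x))"
    unfolding mean by (rule integrable_exp_iid_mean'[OF iid integrable_exp_U exp_U_le t])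
  show "(\<integral>x. exp (t * x) \<partial>D\<^sub>U) \<le> exp (t + t\<^sup>2 * K\<^sub>U / n)"
    using expectation_exp_iid_mean_le[OF iid integrable_exp_U exp_U_le t]
    by (simp only: mean card expectation_U mult_1_right)
qed

section \<open>Increment of the queue, with \<open>r\<close> standing for the inverse load\<close>

context
  fixes r :: real
  assumes r: "1 \<le> r"
begin

abbreviation (input) "increment \<equiv> (\<lambda>(x :: real, y :: real). x - r * y)"

text \<open>Both row means have mean 1, so the mean contributions
  \<open>1 - 2 * r + r\<^sup>2\<close> collect into \<open>(1 - r)\<^sup>2\<close>, leaving the
  variances scaled by \<open>1 / n\<close>.\<close>

lemma
  shows expectation_increment: "integral\<^sup>L (D\<^sub>V \<Otimes>\<^sub>M D\<^sub>U) increment = 1 - r"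
    and expectation_increment_square: "(\<integral>z. (increment z)\<^sup>2 \<partial>(D\<^sub>V \<Otimes>\<^sub>M D\<^sub>U))
      = (variance V + r\<^sup>2 * variance U) / n + (1 - r)\<^sup>2"
proof -
  interpret D\<^sub>V: prob_space D\<^sub>V by (rule prob_space_row_mean_V)
  interpret D\<^sub>U: prob_space D\<^sub>U by (rule prob_space_row_mean_U)
  interpret D: pair_prob_space D\<^sub>V D\<^sub>U ..
  have int: "integrable D\<^sub>U (\<lambda>y. r * y)" "integrable D\<^sub>U (\<lambda>y. (r * y)\<^sup>2)"
    using integrable_row_mean_U integrable_row_mean_U_square by (simp_all add: power_mult_distrib)
  show "integral\<^sup>L (D\<^sub>V \<Otimes>\<^sub>M D\<^sub>U) increment = 1 - r"
    using D.expectation_diff_fst_snd[OF integrable_row_mean_V integrable_row_mean_V_square int]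
    by (simp add: expectation_row_mean_V expectation_row_mean_U)
  show "(\<integral>z. (increment z)\<^sup>2 \<partial>(D\<^sub>V \<Otimes>\<^sub>M D\<^sub>U)) = (variance V + r\<^sup>2 * variance U) / n + (1 - r)\<^sup>2"
    using D.expectation_diff_fst_snd_square[OF integrable_row_mean_V integrable_row_mean_V_square int]
    by (simp add: expectation_row_mean_V expectation_row_mean_U expectation_row_mean_V_square
        expectation_row_mean_U_square power_mult_distrib case_prod_unfold power2_diff)
      (simp add: algebra_simps add_divide_distrib)
qed

text \<open>The linear exponents of the two means nearly cancel, leaving only
  \<open>s * (r - 1)\<close>. As \<open>1 \<le> r\<close>, the sign giving
  \<open>s * (r - 1)\<close> is the worse one, whence the factor 2, and the condition on
  \<open>s * r\<close> covers the transform of the service mean too.\<close>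

lemma
  assumes s: "0 < s" "s * r / n \<le> \<eta>"
  shows integrable_exp_increment: "integrable (D\<^sub>V \<Otimes>\<^sub>M D\<^sub>U) (\<lambda>z. exp (s * \<bar>increment z\<bar>))"
    and exp_increment_le: "(\<integral>z. exp (s * \<bar>increment z\<bar>) \<partial>(D\<^sub>V \<Otimes>\<^sub>M D\<^sub>U))
      \<le> 2 * exp (s * (r - 1) + s\<^sup>2 * (K\<^sub>V + r\<^sup>2 * K\<^sub>U) / n)"
proof -
  interpret D\<^sub>V: prob_space D\<^sub>V by (rule prob_space_row_mean_V)
  interpret D\<^sub>U: prob_space D\<^sub>U by (rule prob_space_row_mean_U)
  interpret D: pair_prob_space D\<^sub>V D\<^sub>U ..
  have meas: "(\<lambda>x. x) \<in> borel_measurable D\<^sub>V" "(\<lambda>y. r * y) \<in> borel_measurable D\<^sub>U"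
    by simp_all
  have "s / n \<le> s * r / n"
    using s r by (intro divide_right_mono) auto
  then have t: "\<bar>s\<bar> / n \<le> \<eta>" "\<bar>- s\<bar> / n \<le> \<eta>" "\<bar>s * r\<bar> / n \<le> \<eta>" "\<bar>- s * r\<bar> / n \<le> \<eta>"
    using s r by (auto simp: abs_mult)
  have intV: "integrable D\<^sub>V (\<lambda>x. exp (s * x))" "integrable D\<^sub>V (\<lambda>x. exp (- s * x))"
    using integrable_exp_row_mean_V t by blast+
  have intU: "integrable D\<^sub>U (\<lambda>y. exp (s * (r * y)))" "integrable D\<^sub>U (\<lambda>y. exp (- s * (r * y)))"
    using integrable_exp_row_mean_U[OF t(3)] integrable_exp_row_mean_U[OF t(4)] by (simp_all add: mult.assoc)
  have V_le: "(\<integral>x. exp (s * x) \<partial>D\<^sub>V) \<le> exp (s + s\<^sup>2 * K\<^sub>V / n)"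
    "(\<integral>x. exp (- s * x) \<partial>D\<^sub>V) \<le> exp (- s + s\<^sup>2 * K\<^sub>V / n)"
    using exp_row_mean_V_le[OF t(1)] exp_row_mean_V_le[OF t(2)] by simp_all
  have U_le: "(\<integral>y. exp (s * (r * y)) \<partial>D\<^sub>U) \<le> exp (s * r + (s * r)\<^sup>2 * K\<^sub>U / n)"
    "(\<integral>y. exp (- s * (r * y)) \<partial>D\<^sub>U) \<le> exp (- (s * r) + (s * r)\<^sup>2 * K\<^sub>U / n)"
    using exp_row_mean_U_le[OF t(3)] exp_row_mean_U_le[OF t(4)] by (simp_all add: mult.assoc)
  show "integrable (D\<^sub>V \<Otimes>\<^sub>M D\<^sub>U) (\<lambda>z. exp (s * \<bar>increment z\<bar>))"
    using D.integrable_exp_abs_diff_fst_snd[OF meas intV intU] by (simp add: case_prod_unfold)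
  have "(\<integral>z. exp (s * \<bar>increment z\<bar>) \<partial>(D\<^sub>V \<Otimes>\<^sub>M D\<^sub>U))
      \<le> (\<integral>x. exp (s * x) \<partial>D\<^sub>V) * (\<integral>y. exp (- s * (r * y)) \<partial>D\<^sub>U)
        + (\<integral>x. exp (- s * x) \<partial>D\<^sub>V) * (\<integral>y. exp (s * (r * y)) \<partial>D\<^sub>U)"
    using D.expectation_exp_abs_diff_fst_snd_le[OF meas intV intU] by (simp add: case_prod_unfold)
  also have "\<dots> \<le> exp (s + s\<^sup>2 * K\<^sub>V / n) * exp (- (s * r) + (s * r)\<^sup>2 * K\<^sub>U / n)
      + exp (- s + s\<^sup>2 * K\<^sub>V / n) * exp (s * r + (s * r)\<^sup>2 * K\<^sub>U / n)"
    by (intro add_mono mult_mono V_le U_le) auto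
  also have "\<dots> = exp (- (s * (r - 1)) + s\<^sup>2 * (K\<^sub>V + r\<^sup>2 * K\<^sub>U) / n) + exp (s * (r - 1) + s\<^sup>2 * (K\<^sub>V + r\<^sup>2 * K\<^sub>U) / n)"
    by (simp add: algebra_simps add_divide_distrib power_mult_distrib flip: exp_add)
  also have "exp (- (s * (r - 1)) + s\<^sup>2 * (K\<^sub>V + r\<^sup>2 * K\<^sub>U) / n) \<le> exp (s * (r - 1) + s\<^sup>2 * (K\<^sub>V + r\<^sup>2 * K\<^sub>U) / n)"
    using s r by simp
  finally show "(\<integral>z. exp (s * \<bar>increment z\<bar>) \<partial>(D\<^sub>V \<Otimes>\<^sub>M D\<^sub>U))
      \<le> 2 * exp (s * (r - 1) + s\<^sup>2 * (K\<^sub>V + r\<^sup>2 * K\<^sub>U) / n)"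
    by simp
qed

text \<open>The load is passed as \<open>1 / r\<close> because the definition of the waiting time
  divides by it. The right-hand side there is already a product of marginal laws, so only the
  nesting of pairs has to be matched.\<close>

lemma lindley_equilibrium_waiting_time:
  assumes "steady_state_waiting_time M (row_mean VV n) (row_mean UU n) (1 / r) w"
  shows "lindley_equilibrium (distr M borel w) (D\<^sub>V \<Otimes>\<^sub>M D\<^sub>U) increment"
proof -
  have [measurable]: "w \<in> borel_measurable M" and nonneg: "AE x in M. 0 \<le> w x"
    and eq: "distr M borel w = distr (distr M borel w \<Otimes>\<^sub>M (D\<^sub>V \<Otimes>\<^sub>M D\<^sub>U)) borel
         (\<lambda>(w, x, y). max 0 (w + x - r * y))"
    using assms by (simp_all add: steady_state_waiting_time_def)
  interpret D\<^sub>V: prob_space D\<^sub>V by (rule prob_space_row_mean_V)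
  interpret D\<^sub>U: prob_space D\<^sub>U by (rule prob_space_row_mean_U)
  interpret D: pair_prob_space D\<^sub>V D\<^sub>U ..
  interpret W: prob_space "distr M borel w" by (rule prob_space_distr) simp
  interpret pair_prob_space "distr M borel w" "D\<^sub>V \<Otimes>\<^sub>M D\<^sub>U" ..
  have fun_eq: "(\<lambda>(w, z). max 0 (w + increment z)) = (\<lambda>(w, x, y). max 0 (w + x - r * y))"
    by (auto simp: fun_eq_iff)
  show ?thesis
  proof unfold_locales
    show "AE w in distr M borel w. 0 \<le> w"
      using nonneg by (subst AE_distr_iff) auto
    show "distr (distr M borel w \<Otimes>\<^sub>M (D\<^sub>V \<Otimes>\<^sub>M D\<^sub>U)) borel (\<lambda>(w, z). max 0 (w + increment z)) = distr M borel w"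
      unfolding fun_eq using eq by simp
  qed simp_all
qed

end

end

end

section \<open>Heavy-traffic asymptotics\<close>

text \<open>The analytic core, for plain sequences: dividing the identity by
  \<open>real (Suc k) * m n\<close> gives \<open>w k\<close> as \<open>k * g * w (k - 1)\<close>
  plus errors. Increment moments of order at least 3 and the idle term, divided by
  \<open>m n\<close> of order \<open>1 / n\<close>, are within the claimed error.\<close>

lemma moment_recursion_asymptotics:
  fixes w x idle :: "nat \<Rightarrow> nat \<Rightarrow> real" and m g :: "nat \<Rightarrow> real"
  assumes w_0: "eventually (\<lambda>n. w 0 n = 1) sequentially"
    and identity: "\<And>k. eventually (\<lambda>n. (\<Sum>j = 1..Suc k. real (Suc k choose j) * w (Suc k - j) n * x j n)
        = (- 1) ^ Suc k * idle k n) sequentially"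
    and x_1: "eventually (\<lambda>n. x 1 n = - m n) sequentially"
    and x_2: "eventually (\<lambda>n. x 2 n = 2 * m n * g n + (m n)\<^sup>2) sequentially"
    and m_pos: "eventually (\<lambda>n. 0 < m n) sequentially"
    and m_bigo: "m \<in> O(\<lambda>n. 1 / real n)" and inverse_m_bigo: "(\<lambda>n. 1 / m n) \<in> O(\<lambda>n. real n)"
    and g_bigo: "g \<in> O(\<lambda>_. 1)"
    and x_bigo: "\<And>j. 3 \<le> j \<Longrightarrow> x j \<in> O(\<lambda>n. 1 / (real n * sqrt (real n)))"
    and idle_bigo: "\<And>k. 1 \<le> k \<Longrightarrow> idle k \<in> O(\<lambda>n. ln (real n) / (real n * sqrt (real n)))"
  shows "(\<lambda>n. w k n - fact k * g n ^ k) \<in> O(\<lambda>n. ln (real n) / sqrt (real n))"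
proof (induction k rule: less_induct)
  case (less k)
  let ?E = "\<lambda>n. ln (real n) / sqrt (real n)"
  have E_bigo: "?E \<in> O(\<lambda>_. 1)"
    by real_asymp
  have g_power: "(\<lambda>n. fact i * g n ^ i) \<in> O(\<lambda>_. 1)" for i
    using landau_o.big_power[OF g_bigo, of i] by simp
  \<comment> \<open>By the induction hypothesis lower moments differ from bounded quantities by a
    vanishing error.\<close>
  have w_bigo: "w i \<in> O(\<lambda>_. 1)" if "i < k" for i
    using sum_in_bigo(1)[OF landau_o.big_trans[OF less[OF that] E_bigo] g_power[of i]] by simp
  show ?case
  proof (cases "k = 0")
    case True
    have "eventually (\<lambda>n. w k n - fact k * g n ^ k = 0) sequentially"
      using w_0 True by simp
    then show ?thesis
      by (subst landau_o.big.in_cong, assumption) simp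
  next
    case False
    then have k: "1 \<le> k" "k - 1 < k"
      by auto
    \<comment> \<open>Everything beyond the terms \<open>j = 1\<close> and \<open>j = 2\<close>; the
      sum is empty for \<open>k = 1\<close>.\<close>
    define R where "R n = (\<Sum>j = 3..Suc k. real (Suc k choose j) * w (Suc k - j) n * x j n)" for n
    have choose_2: "real (Suc k choose 2) = real (Suc k) * real k / 2"
      by (simp add: choose_two real_of_nat_div) (simp add: algebra_simps)
    have split: "(\<Sum>j = 1..Suc k. f j) = f 1 + f 2 + (\<Sum>j = 3..Suc k. f j)" for f :: "nat \<Rightarrow> real"
      using k(1) sum.atLeast_Suc_atMost[of 1 "Suc k" f] sum.atLeast_Suc_atMost[of 2 "Suc k" f]
      by (simp add: numeral_2_eq_2 numeral_3_eq_3 del: sum.cl_ivl_Suc)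
    \<comment> \<open>As \<open>fact k * g n ^ k\<close> satisfies the recursion without error
      terms, the previous error is merely multiplied by \<open>real k * g n\<close>.\<close>
    have eq: "eventually (\<lambda>n. w k n - fact k * g n ^ k =
        real k * (g n * (w (k - 1) n - fact (k - 1) * g n ^ (k - 1))) + real k / 2 * (m n * w (k - 1) n)
        + 1 / real (Suc k) * ((R n - (- 1) ^ Suc k * idle k n) * (1 / m n))) sequentially"
      using identity[of k] x_1 x_2 m_pos
    proof eventually_elim
      case (elim n)
      have "- (real (Suc k) * w k n * m n) + real (Suc k) * real k / 2 * w (k - 1) n * (2 * m n * g n + (m n)\<^sup>2) + R n
          = (- 1) ^ Suc k * idle k n"
        using elim(1) unfolding split R_def[symmetric] elim(2,3) choose_2 using k(1)
        by (simp add: numeral_2_eq_2 del: of_nat_Suc)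
      then have "real (Suc k) * m n * w k n = real (Suc k) * m n * (real k * (g n * w (k - 1) n)
          + real k / 2 * (m n * w (k - 1) n)) + (R n - (- 1) ^ Suc k * idle k n)"
        by (simp add: algebra_simps power2_eq_square add_divide_distrib del: of_nat_Suc power_Suc)
      then have "w k n = real k * (g n * w (k - 1) n) + real k / 2 * (m n * w (k - 1) n)
          + 1 / real (Suc k) * ((R n - (- 1) ^ Suc k * idle k n) * (1 / m n))"
        using elim(4) by (simp add: divide_simps del: of_nat_Suc power_Suc) (simp add: algebra_simps del: of_nat_Suc power_Suc)
      moreover have "fact k * g n ^ k = real k * (g n * (fact (k - 1) * g n ^ (k - 1)))"
        using k(1) by (cases k) (simp_all add: algebra_simps)
      ultimately show ?case
        by (simp add: algebra_simps del: of_nat_Suc power_Suc)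
    qed
    have "(\<lambda>n. real k * (g n * (w (k - 1) n - fact (k - 1) * g n ^ (k - 1)))) \<in> O(?E)"
      using landau_o.big.mult[OF g_bigo less[OF k(2)]] by simp
    moreover have "(\<lambda>n. real k / 2 * (m n * w (k - 1) n)) \<in> O(?E)"
    proof -
      have "(\<lambda>n. m n * w (k - 1) n) \<in> O(\<lambda>n. 1 / real n)"
        using landau_o.big.mult[OF m_bigo w_bigo[OF k(2)]] by simp
      also have "(\<lambda>n. 1 / real n) \<in> O(?E)"
        by real_asymp
      finally show ?thesis
        by simp
    qed
    moreover have "(\<lambda>n. 1 / real (Suc k) * ((R n - (- 1) ^ Suc k * idle k n) * (1 / m n))) \<in> O(?E)"
    proof -
      have "R \<in> O(\<lambda>n. 1 / (real n * sqrt (real n)))"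
        unfolding R_def
      proof (rule big_sum_in_bigo)
        fix j assume j: "j \<in> {3..Suc k}"
        then have "Suc k - j < k"
          by auto
        from landau_o.big.mult[OF w_bigo[OF this] x_bigo[of j]] j
        have "(\<lambda>n. w (Suc k - j) n * x j n) \<in> O(\<lambda>n. 1 / (real n * sqrt (real n)))"
          by simp
        from landau_o.big.mult[OF bigo_const[of "real (Suc k choose j)"] this]
        show "(\<lambda>n. real (Suc k choose j) * w (Suc k - j) n * x j n) \<in> O(\<lambda>n. 1 / (real n * sqrt (real n)))"
          by (simp add: mult.assoc del: binomial_Suc_Suc)
      qed
      also have "(\<lambda>n. 1 / (real n * sqrt (real n))) \<in> O(\<lambda>n. ln (real n) / (real n * sqrt (real n)))"
        by real_asymp
      finally have "(\<lambda>n. R n - (- 1) ^ Suc k * idle k n) \<in> O(\<lambda>n. ln (real n) / (real n * sqrt (real n)))"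
        using idle_bigo[OF k(1)] by (intro sum_in_bigo) (auto simp del: power_Suc)
      from landau_o.big.mult[OF this inverse_m_bigo]
      have "(\<lambda>n. (R n - (- 1) ^ Suc k * idle k n) * (1 / m n)) \<in> O(\<lambda>n. ln (real n) / (real n * sqrt (real n)) * real n)" .
      also have "(\<lambda>n. ln (real n) / (real n * sqrt (real n)) * real n) \<in> O(?E)"
        by real_asymp
      finally show ?thesis
        using landau_o.big.mult[OF bigo_const[of "1 / real (Suc k)"]] by fastforce
    qed
    ultimately show ?thesis
      by (intro landau_o.big.in_cong[OF eq, THEN iffD2] sum_in_bigo)
  qed
qed

theorem mainTheorem4:
  fixes M :: "'a measure"
    and V U :: "'a \<Rightarrow> real"
    and VV UU :: "nat \<Rightarrow> nat \<Rightarrow> 'a \<Rightarrow> real"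
    and W :: "nat \<Rightarrow> 'a \<Rightarrow> real"
    and \<rho> \<gamma> :: "nat \<Rightarrow> real"
    and \<delta> \<beta>\<^sub>1 \<beta>\<^sub>2 varV varU :: real
    and k :: nat
  assumes "prob_space M"
    and "prob_space.indep_var M borel V borel U"
    and "AE \<omega> in M. 0 \<le> V \<omega>" and "AE \<omega> in M. 0 \<le> U \<omega>"
    and "prob_space.expectation M V = 1" and "prob_space.expectation M U = 1"
    and "integrable M (\<lambda>\<omega>. (V \<omega>)\<^sup>2)" and "integrable M (\<lambda>\<omega>. (U \<omega>)\<^sup>2)"
    and "varV = prob_space.variance M V" and "varU = prob_space.variance M U"
    and "0 < varV + varU"
    and "\<delta> > 0"
    and "mgf_analytic_beyond_strip M V \<delta>" and "mgf_analytic_beyond_strip M U \<delta>"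
    and "0 < \<beta>\<^sub>1" and "\<beta>\<^sub>1 \<le> \<beta>\<^sub>2"
    and "\<And>n. n \<ge> 1 \<Longrightarrow> 0 < \<rho> n \<and> \<rho> n < 1"
    and "\<And>n. n \<ge> 1 \<Longrightarrow> (1 - \<rho> n) * real n \<in> {\<beta>\<^sub>1..\<beta>\<^sub>2}"
    and "iid_copy_arrays M V U VV UU"
    and "\<And>n. n \<ge> 1 \<Longrightarrow>
           steady_state_waiting_time M (row_mean VV n) (row_mean UU n) (\<rho> n) (W n)"
    and "\<And>n. n \<ge> 1 \<Longrightarrow>
           \<gamma> n = (varV + (1 / (\<rho> n)\<^sup>2) * varU) * \<rho> n / (2 * real n * (1 - \<rho> n))"
    and "k \<ge> 1"
  shows "(\<forall>n\<ge>1. integrable M (\<lambda>\<omega>. W n \<omega> ^ k)) \<and>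
         (\<lambda>n. prob_space.expectation M (\<lambda>\<omega>. W n \<omega> ^ k) - fact k * \<gamma> n ^ k)
           \<in> O(\<lambda>n. ln (real n) / sqrt (real n))"
proof -
  interpret prob_space M by fact
  have [measurable]: "V \<in> borel_measurable M" "U \<in> borel_measurable M"
    using assms(2) indep_var_rv1 indep_var_rv2 by blast+
  obtain K\<^sub>V where K\<^sub>V: "0 \<le> K\<^sub>V"
    "\<And>s. \<bar>s\<bar> \<le> \<delta> / 2 \<Longrightarrow> integrable M (\<lambda>x. exp (s * V x))"
    "\<And>s. \<bar>s\<bar> \<le> \<delta> / 2 \<Longrightarrow> expectation (\<lambda>x. exp (s * V x)) \<le> 1 + s * expectation V + s\<^sup>2 * K\<^sub>V"
    using exp_moment_quadratic_bound[OF _ \<open>\<delta> > 0\<close> integrable_exp_abs_of_mgf[OF _ \<open>\<delta> > 0\<close> assms(13)]] by auto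
  obtain K\<^sub>U where K\<^sub>U: "0 \<le> K\<^sub>U"
    "\<And>s. \<bar>s\<bar> \<le> \<delta> / 2 \<Longrightarrow> integrable M (\<lambda>x. exp (s * U x))"
    "\<And>s. \<bar>s\<bar> \<le> \<delta> / 2 \<Longrightarrow> expectation (\<lambda>x. exp (s * U x)) \<le> 1 + s * expectation U + s\<^sup>2 * K\<^sub>U"
    using exp_moment_quadratic_bound[OF _ \<open>\<delta> > 0\<close> integrable_exp_abs_of_mgf[OF _ \<open>\<delta> > 0\<close> assms(14)]] by auto
  \<comment> \<open>A non-integrable function would have integral 0 by convention, contradicting
    mean 1.\<close>
  have "integrable M V" "integrable M U"
    using assms(5,6) not_integrable_integral_eq[of M V] not_integrable_integral_eq[of M U] by auto
  then interpret nearly_deterministic_queue M V U VV UU "\<delta> / 2" K\<^sub>V K\<^sub>U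
    using assms(5-8,19) K\<^sub>V K\<^sub>U by unfold_locales simp_all

  \<comment> \<open>The sequences fed into the recursion and their exact identities\<close>
  define r where "r n = 1 / \<rho> n" for n
  define m where "m n = r n - 1" for n
  define N where "N n = distr M borel (row_mean VV n) \<Otimes>\<^sub>M distr M borel (row_mean UU n)" for n
  define X where "X n = (\<lambda>(x :: real, y :: real). x - r n * y)" for n
  define w where "w j n = expectation (\<lambda>\<omega>. W n \<omega> ^ j)" for j n
  define x where "x j n = (\<integral>z. X n z ^ j \<partial>N n)" for j n
  \<comment> \<open>The index is shifted: \<open>idle j n\<close> is the moment of order
    \<open>j + 1\<close> of the negative part.\<close>
  define idle where "idle j n = integral\<^sup>L (distr M borel (W n) \<Otimes>\<^sub>M N n) (\<lambda>(w, z). max 0 (- (w + X n z)) ^ Suc j)" for j n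

  have r: "1 \<le> r n" and m_pos: "0 < m n" if "1 \<le> n" for n
    using assms(17)[OF that] by (auto simp: r_def m_def)
  have meas_W: "W n \<in> borel_measurable M" if "1 \<le> n" for n
    using assms(20)[OF that] by (simp add: steady_state_waiting_time_def)
  have queue: "lindley_equilibrium (distr M borel (W n)) (N n) (X n)" if "1 \<le> n" for n
    unfolding N_def X_def using assms(20)[OF that]
    by (intro lindley_equilibrium_waiting_time that r) (simp add: r_def)
  have drift: "(\<integral>z. X n z \<partial>N n) = - m n" if "1 \<le> n" for n
    unfolding N_def X_def m_def using expectation_increment[OF that r[OF that]] by simp
  have drift_neg: "(\<integral>z. X n z \<partial>N n) < 0" if "1 \<le> n" for n
    using drift[OF that] m_pos[OF that] by simp
  have int_exp: "integrable (N n) (\<lambda>z. exp (s * \<bar>X n z\<bar>))" if "1 \<le> n" "0 < s" "s * r n / n \<le> \<delta> / 2" for n s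
    unfolding N_def X_def by (rule integrable_exp_increment[OF that(1) r[OF that(1)] that(2,3)])
  have small_s: "0 < \<delta> / 2 * n / r n" "\<delta> / 2 * n / r n * r n / n \<le> \<delta> / 2" if "1 \<le> n" for n
    using r[OF that] that \<open>\<delta> > 0\<close> by (auto intro!: divide_pos_pos mult_pos_pos)
  have integrable_W: "integrable M (\<lambda>\<omega>. W n \<omega> ^ j)" if "1 \<le> n" for n j
    using lindley_equilibrium.integrable_power_equilibrium[OF queue[OF that] small_s(1)[OF that] int_exp[OF that small_s[OF that]] drift_neg[OF that], of j]
      meas_W[OF that] by (simp add: integrable_distr_eq)
  have moment_W: "(\<integral>y. y ^ j \<partial>distr M borel (W n)) = w j n" if "1 \<le> n" for n j
    using meas_W[OF that] by (simp add: integral_distr w_def)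
  have identity: "(\<Sum>j = 1..Suc k. real (Suc k choose j) * w (Suc k - j) n * x j n) = (- 1) ^ Suc k * idle k n"
    if "1 \<le> n" for n k
    using lindley_equilibrium.moment_identity[OF queue[OF that] small_s(1)[OF that] int_exp[OF that small_s[OF that]] drift_neg[OF that], of k]
    unfolding moment_W[OF that] x_def[symmetric] idle_def[symmetric] .

  \<comment> \<open>From \<open>n \<ge> 2 * \<beta>\<^sub>2\<close> and
    \<open>(1 - \<rho> n) * n \<le> \<beta>\<^sub>2\<close> follows
    \<open>\<rho> n \<ge> 1 / 2\<close>, hence \<open>r n \<le> 2\<close>; adding 1 ensures
    \<open>n \<ge> 1\<close>.\<close>
  define n\<^sub>0 where "n\<^sub>0 = nat \<lceil>2 * \<beta>\<^sub>2\<rceil> + 1"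
  have n\<^sub>0: "1 \<le> n" if "n\<^sub>0 \<le> n" for n
    using that by (simp add: n\<^sub>0_def)
  have large: "r n \<le> 2" "m n * n \<le> 2 * \<beta>\<^sub>2" "\<beta>\<^sub>1 \<le> m n * n" if "n\<^sub>0 \<le> n" for n
  proof -
    have n: "1 \<le> n" "2 * \<beta>\<^sub>2 \<le> n"
      using that unfolding n\<^sub>0_def by linarith+
    have \<rho>: "0 < \<rho> n" "\<rho> n < 1" "\<beta>\<^sub>1 \<le> (1 - \<rho> n) * n" "(1 - \<rho> n) * n \<le> \<beta>\<^sub>2"
      using assms(17,18) n(1) by auto
    have "(1 - \<rho> n) * n \<le> 1 / 2 * n"
      using \<rho>(4) n(2) by simp
    then have half: "1 / 2 \<le> \<rho> n"
      using n(1) by (subst (asm) mult_le_cancel_right) auto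
    then show r_le: "r n \<le> 2"
      using \<rho>(1) by (simp add: r_def field_simps)
    have m: "m n * n = r n * ((1 - \<rho> n) * n)"
      using \<rho>(1) by (simp add: m_def r_def field_simps)
    show "m n * n \<le> 2 * \<beta>\<^sub>2"
      unfolding m using r_le \<rho> r[OF n(1)] assms(15) by (intro mult_mono) auto
    have "1 * ((1 - \<rho> n) * n) \<le> r n * ((1 - \<rho> n) * n)"
      using \<rho> r[OF n(1)] by (intro mult_right_mono) auto
    then show "\<beta>\<^sub>1 \<le> m n * n"
      unfolding m using \<rho>(3) by simp
  qed
  \<comment> \<open>As \<open>m n = (1 - \<rho> n) / \<rho> n\<close>, the normalisation of
    \<open>\<gamma>\<close> makes \<open>2 * m n * \<gamma> n\<close> exactly the variance of the
    increment.\<close>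
  have x_2: "x 2 n = 2 * m n * \<gamma> n + (m n)\<^sup>2" if "1 \<le> n" for n
  proof -
    have \<rho>: "0 < \<rho> n" "\<rho> n < 1"
      using assms(17) that by auto
    have "x 2 n = (varV + (r n)\<^sup>2 * varU) / n + (m n)\<^sup>2"
      unfolding x_def N_def X_def m_def assms(9,10)
      using expectation_increment_square[OF that r[OF that]] by (simp add: power2_commute)
    moreover have "2 * m n * \<gamma> n = (varV + (r n)\<^sup>2 * varU) / n"
    proof -
      have \<gamma>: "\<gamma> n = (varV + (r n)\<^sup>2 * varU) * (\<rho> n / (2 * n * (1 - \<rho> n)))"
        using assms(21)[OF that] by (simp add: r_def power_divide)
      have "2 * m n * (\<rho> n / (2 * n * (1 - \<rho> n))) = 1 / n"
        using \<rho> that by (simp add: m_def r_def divide_simps)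
      then have "(varV + (r n)\<^sup>2 * varU) * (2 * m n * (\<rho> n / (2 * n * (1 - \<rho> n)))) = (varV + (r n)\<^sup>2 * varU) / n"
        by simp
      then show ?thesis
        unfolding \<gamma> by (simp only: mult_ac)
    qed
    ultimately show ?thesis
      by simp
  qed

  \<comment> \<open>For \<open>r n \<le> 2\<close> the rate \<open>c * sqrt n\<close> satisfies the
    smallness condition with bound \<open>\<delta> / 2\<close>. In \<open>L\<close>, the linear part
    of the exponent is bounded using
    \<open>sqrt n * m n \<le> n * m n \<le> 2 * \<beta>\<^sub>2\<close> and the quadratic part using
    \<open>(r n)\<^sup>2 \<le> 4\<close>.\<close>
  define c where "c = \<delta> / 4"
  define L where "L = 2 * exp (2 * c * \<beta>\<^sub>2 + c\<^sup>2 * (K\<^sub>V + 4 * K\<^sub>U))"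
  have c: "0 < c"
    using \<open>\<delta> > 0\<close> by (simp add: c_def)
  have exp_moment: "integrable (N n) (\<lambda>z. exp (c * sqrt n * \<bar>X n z\<bar>))"
    "(\<integral>z. exp (c * sqrt n * \<bar>X n z\<bar>) \<partial>N n) \<le> L" if "n\<^sub>0 \<le> n" for n
  proof -
    note n = n\<^sub>0[OF that]
    have sqrt_n: "1 \<le> sqrt n" "sqrt n * sqrt n = n"
      using n by auto
    have "c * sqrt n * r n \<le> c * sqrt n * 2"
      using c large(1)[OF that] by (intro mult_left_mono) auto
    also have "\<dots> \<le> \<delta> / 2 * n"
      using sqrt_n \<open>\<delta> > 0\<close> mult_left_mono[of 1 "sqrt n" "sqrt n"] by (simp add: c_def)
    finally have s: "c * sqrt n * r n / n \<le> \<delta> / 2"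
      using n by (simp add: divide_simps)
    have s_pos: "0 < c * sqrt n"
      using c n by simp
    show "integrable (N n) (\<lambda>z. exp (c * sqrt n * \<bar>X n z\<bar>))"
      by (rule int_exp[OF n s_pos s])
    have "sqrt n * m n \<le> n * m n"
      using sqrt_n mult_right_mono[of 1 "sqrt n" "sqrt n"] m_pos[OF n] by (intro mult_right_mono) auto
    then have "c * (sqrt n * m n) \<le> c * (2 * \<beta>\<^sub>2)"
      using c large(2)[OF that] by (intro mult_left_mono) (auto simp: mult.commute)
    moreover have "c\<^sup>2 * (K\<^sub>V + (r n)\<^sup>2 * K\<^sub>U) \<le> c\<^sup>2 * (K\<^sub>V + 2\<^sup>2 * K\<^sub>U)"
      using K\<^sub>U(1) large(1)[OF that] r[OF n] by (intro mult_left_mono add_left_mono mult_right_mono power_mono) auto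
    ultimately have "c * sqrt n * (r n - 1) + (c * sqrt n)\<^sup>2 * (K\<^sub>V + (r n)\<^sup>2 * K\<^sub>U) / n
        \<le> 2 * c * \<beta>\<^sub>2 + c\<^sup>2 * (K\<^sub>V + 4 * K\<^sub>U)"
      using n by (simp add: power_mult_distrib m_def mult.assoc)
    then show "(\<integral>z. exp (c * sqrt n * \<bar>X n z\<bar>) \<partial>N n) \<le> L"
      using exp_increment_le[OF n r[OF n] s_pos s] unfolding N_def X_def L_def
      by (elim order.trans) simp
  qed
  have L: "0 \<le> L"
    by (simp add: L_def)

  \<comment> \<open>Orders of magnitude in \<open>n\<close>\<close>
  have large_n: "eventually (\<lambda>n. n\<^sub>0 \<le> n) sequentially" and pos_n: "eventually (\<lambda>n. 1 \<le> n) sequentially"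
    by (rule eventually_ge_at_top)+
  have m_bigo: "m \<in> O(\<lambda>n. 1 / real n)"
  proof (rule bigoI[where c = "2 * \<beta>\<^sub>2"])
    show "eventually (\<lambda>n. norm (m n) \<le> 2 * \<beta>\<^sub>2 * norm (1 / real n)) sequentially"
      using large_n
    proof eventually_elim
      case (elim n)
      then show ?case
        using large(2)[OF elim] m_pos[OF n\<^sub>0[OF elim]] n\<^sub>0[OF elim] by (simp add: field_simps)
    qed
  qed
  have inverse_m_le: "1 / m n \<le> n / \<beta>\<^sub>1" if "n\<^sub>0 \<le> n" for n
    using large(3)[OF that] m_pos[OF n\<^sub>0[OF that]] assms(15) by (simp add: field_simps)
  have inverse_m_bigo: "(\<lambda>n. 1 / m n) \<in> O(\<lambda>n. real n)"
  proof (rule bigoI[where c = "1 / \<beta>\<^sub>1"])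
    show "eventually (\<lambda>n. norm (1 / m n) \<le> 1 / \<beta>\<^sub>1 * norm (real n)) sequentially"
      using large_n
    proof eventually_elim
      case (elim n)
      then show ?case
        using inverse_m_le[OF elim] m_pos[OF n\<^sub>0[OF elim]] by simp
    qed
  qed
  have x_bigo: "x j \<in> O(\<lambda>n. 1 / sqrt (real n) ^ j)" for j
  proof (rule bigoI[where c = "fact j / c ^ j * L"])
    show "eventually (\<lambda>n. norm (x j n) \<le> fact j / c ^ j * L * norm (1 / sqrt (real n) ^ j)) sequentially"
      using large_n
    proof eventually_elim
      case (elim n)
      note n = n\<^sub>0[OF elim]
      have s_pos: "0 < c * sqrt n"
        using c n by simp
      have "norm (x j n) \<le> (\<integral>z. \<bar>X n z\<bar> ^ j \<partial>N n)"
        unfolding x_def using integral_norm_bound[of "N n" "\<lambda>z. X n z ^ j"] by (simp add: power_abs)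
      also have "\<dots> \<le> fact j / (c * sqrt n) ^ j * (\<integral>z. exp (c * sqrt n * \<bar>X n z\<bar>) \<partial>N n)"
        by (rule lindley_equilibrium.abs_moment_increment_le[OF queue[OF n] s_pos exp_moment(1)[OF elim] drift_neg[OF n]])
      also have "\<dots> \<le> fact j / (c * sqrt n) ^ j * L"
        using c exp_moment(2)[OF elim] by (intro mult_left_mono) auto
      finally show ?case
        by (simp add: power_mult_distrib power_abs)
    qed
  qed
  \<comment> \<open>Solving the second-moment identity for \<open>\<gamma>\<close> gives
    \<open>(x 2 n - m n * m n) / (2 * m n)\<close>, a numerator of order at most
    \<open>1 / n\<close> times a factor of order \<open>n\<close>.\<close>
  have g_bigo: "\<gamma> \<in> O(\<lambda>_. 1)"
  proof -
    have sqrt_sq: "(\<lambda>n. 1 / sqrt (real n) ^ 2) = (\<lambda>n. 1 / real n)"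
      by (auto simp: fun_eq_iff)
    have "(\<lambda>n. m n * m n) \<in> O(\<lambda>n. 1 / real n * (1 / real n))"
      by (rule landau_o.big.mult[OF m_bigo m_bigo])
    also have "(\<lambda>n. 1 / real n * (1 / real n)) \<in> O(\<lambda>n. 1 / real n)"
      by real_asymp
    finally have "(\<lambda>n. x 2 n - m n * m n) \<in> O(\<lambda>n. 1 / real n)"
      using x_bigo[of 2] unfolding sqrt_sq by (intro sum_in_bigo)
    from landau_o.big.mult[OF this inverse_m_bigo]
    have "(\<lambda>n. (x 2 n - m n * m n) * (1 / m n)) \<in> O(\<lambda>n. 1 / real n * real n)" .
    also have "(\<lambda>n. 1 / real n * real n) \<in> O(\<lambda>_. 1 :: real)"
      by real_asymp
    finally have "(\<lambda>n. (x 2 n - m n * m n) * (1 / m n)) \<in> O(\<lambda>_. 1)" .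
    from landau_o.big.mult[OF bigo_const[of "1 / 2"] this]
    have "(\<lambda>n. 1 / 2 * ((x 2 n - m n * m n) * (1 / m n))) \<in> O(\<lambda>_. 1)"
      by (simp only: mult_1_left)
    moreover have eq: "eventually (\<lambda>n. \<gamma> n = 1 / 2 * ((x 2 n - m n * m n) * (1 / m n))) sequentially"
      using pos_n
    proof eventually_elim
      case (elim n)
      then show ?case
        using x_2[OF elim] m_pos[OF elim] by (simp add: power2_eq_square)
    qed
    ultimately show ?thesis
      by (intro landau_o.big.in_cong[OF eq, THEN iffD2])
  qed
  have idle_bigo: "idle k \<in> O(\<lambda>n. ln (real n) / (real n * sqrt (real n)))" if "1 \<le> k" for k
  proof -
    \<comment> \<open>The level is chosen so that at rate \<open>c * sqrt n\<close> the tail factor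
      is exactly \<open>1 / sqrt n\<close>. The tail term also carries
      \<open>1 / sqrt n ^ Suc k\<close>, which for \<open>k \<ge> 1\<close> brings it to order
      \<open>1 / (n * sqrt n)\<close>.\<close>
    define a where "a n = ln (real n) / (c * sqrt (real n))" for n
    define C where "C = fact (Suc k) / (c / 2) ^ Suc k * L"
    have C: "0 \<le> C"
      using c L by (simp add: C_def)
    have idle_le: "norm (idle k n) \<le> a n ^ k * m n + C * (1 / (real n * sqrt (real n)))" if "n\<^sub>0 \<le> n" for n
    proof -
      note n = n\<^sub>0[OF that]
      have s_pos: "0 < c * sqrt n"
        using c n by simp
      have sqrt_n: "1 \<le> sqrt n" "0 < sqrt n"
        using n by auto
      have a: "0 \<le> a n"
        using c n by (simp add: a_def)
      have "exp (- (c * sqrt n * a n / 2)) = exp (- ln (sqrt n))"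
        using c sqrt_n n by (simp add: a_def ln_sqrt)
      also have "\<dots> = 1 / sqrt n"
        using sqrt_n by (simp add: exp_minus inverse_eq_divide)
      finally have exp_a: "exp (- (c * sqrt n * a n / 2)) = 1 / sqrt n" .
      have "idle k n \<le> a n ^ k * - (\<integral>z. X n z \<partial>N n)
          + fact (Suc k) / (c * sqrt n / 2) ^ Suc k * exp (- (c * sqrt n * a n / 2)) * (\<integral>z. exp (c * sqrt n * \<bar>X n z\<bar>) \<partial>N n)"
        unfolding idle_def
        by (rule lindley_equilibrium.idle_moment_le[OF queue[OF n] s_pos exp_moment(1)[OF that] drift_neg[OF n] a])
      also have "\<dots> \<le> a n ^ k * - (\<integral>z. X n z \<partial>N n)
          + fact (Suc k) / (c * sqrt n / 2) ^ Suc k * exp (- (c * sqrt n * a n / 2)) * L"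
        using c exp_moment(2)[OF that] by (intro add_left_mono mult_left_mono) auto
      also have "\<dots> = a n ^ k * m n + C * (1 / (sqrt n ^ Suc k * sqrt n))"
        unfolding drift[OF n] exp_a C_def by (simp add: power_divide power_mult_distrib field_simps del: power_Suc fact_Suc)
      also have "\<dots> \<le> a n ^ k * m n + C * (1 / (n * sqrt n))"
      proof -
        have "sqrt n ^ 2 \<le> sqrt n ^ Suc k"
          using sqrt_n \<open>1 \<le> k\<close> by (intro power_increasing) auto
        then have "n * sqrt n \<le> sqrt n ^ Suc k * sqrt n"
          using sqrt_n by (intro mult_right_mono) auto
        then show ?thesis
          using C sqrt_n n by (intro add_left_mono mult_left_mono frac_le) auto
      qed
      finally have "idle k n \<le> a n ^ k * m n + C * (1 / (n * sqrt n))" .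
      moreover have "0 \<le> idle k n"
        unfolding idle_def by (intro integral_nonneg_AE) (auto simp del: power_Suc)
      ultimately show ?thesis
        by simp
    qed
    have a_bigo: "a \<in> O(\<lambda>n. ln (real n) / sqrt (real n))" "a \<in> O(\<lambda>_. 1)"
      unfolding a_def using c by (real_asymp)+
    \<comment> \<open>One factor \<open>a n\<close> supplies the rate; the remaining
      \<open>k - 1\<close> need only be bounded.\<close>
    have "(\<lambda>n. a n ^ (k - 1) * a n) \<in> O(\<lambda>n. 1 ^ (k - 1) * (ln (real n) / sqrt (real n)))"
      by (intro landau_o.big.mult landau_o.big_power a_bigo)
    moreover have "(\<lambda>n. a n ^ (k - 1) * a n) = (\<lambda>n. a n ^ k)"
      using that by (cases k) (auto simp: mult.commute)
    ultimately have "(\<lambda>n. a n ^ k * m n) \<in> O(\<lambda>n. ln (real n) / sqrt (real n) * (1 / real n))"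
      using m_bigo by (intro landau_o.big.mult) simp_all
    also have "(\<lambda>n. ln (real n) / sqrt (real n) * (1 / real n)) \<in> O(\<lambda>n. ln (real n) / (real n * sqrt (real n)))"
      by real_asymp
    finally have "(\<lambda>n. a n ^ k * m n) \<in> O(\<lambda>n. ln (real n) / (real n * sqrt (real n)))" .
    moreover have "(\<lambda>n. C * (1 / (real n * sqrt (real n)))) \<in> O(\<lambda>n. ln (real n) / (real n * sqrt (real n)))"
      by real_asymp
    ultimately have "(\<lambda>n. a n ^ k * m n + C * (1 / (real n * sqrt (real n)))) \<in> O(\<lambda>n. ln (real n) / (real n * sqrt (real n)))"
      by (rule sum_in_bigo)
    moreover have "idle k \<in> O(\<lambda>n. a n ^ k * m n + C * (1 / (real n * sqrt (real n))))"
    proof (rule bigoI[where c = 1])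
      show "eventually (\<lambda>n. norm (idle k n) \<le> 1 * norm (a n ^ k * m n + C * (1 / (real n * sqrt (real n))))) sequentially"
        using large_n
      proof eventually_elim
        case (elim n)
        then show ?case
          using idle_le[OF elim] by simp
      qed
    qed
    ultimately show ?thesis
      by (rule landau_o.big_trans[rotated])
  qed

  \<comment> \<open>Application of the moment recursion\<close>
  have "(\<lambda>n. w k n - fact k * \<gamma> n ^ k) \<in> O(\<lambda>n. ln (real n) / sqrt (real n))"
  proof (rule moment_recursion_asymptotics[where x = x and idle = idle and m = m,
        OF _ _ _ _ _ m_bigo inverse_m_bigo g_bigo _ idle_bigo])
    show "eventually (\<lambda>n. w 0 n = 1) sequentially"
      by (simp add: w_def prob_space)
    show "eventually (\<lambda>n. (\<Sum>j = 1..Suc k. real (Suc k choose j) * w (Suc k - j) n * x j n)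
        = (- 1) ^ Suc k * idle k n) sequentially" for k
      using pos_n by eventually_elim (rule identity)
    show "eventually (\<lambda>n. x 1 n = - m n) sequentially"
      using pos_n by eventually_elim (simp add: x_def drift)
    show "eventually (\<lambda>n. x 2 n = 2 * m n * \<gamma> n + (m n)\<^sup>2) sequentially"
      using pos_n by eventually_elim (rule x_2)
    show "eventually (\<lambda>n. 0 < m n) sequentially"
      using pos_n by eventually_elim (rule m_pos)
    show "x j \<in> O(\<lambda>n. 1 / (real n * sqrt (real n)))" if "3 \<le> j" for j
    proof (rule landau_o.big_trans[OF x_bigo])
      have "norm (1 / sqrt n ^ j) \<le> 1 * norm (1 / (n * sqrt n))" if "1 \<le> n" for n :: nat
      proof -
        have "sqrt n ^ 3 \<le> sqrt n ^ j"
          using that \<open>3 \<le> j\<close> by (intro power_increasing) simp_all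
        then have "1 / sqrt n ^ j \<le> 1 / (n * sqrt n)"
          using that by (intro frac_le) (simp_all add: power3_eq_cube)
        then show ?thesis
          by simp
      qed
      then show "(\<lambda>n. 1 / sqrt (real n) ^ j) \<in> O(\<lambda>n. 1 / (real n * sqrt (real n)))"
        by (intro bigoI[where c = 1] eventually_mono[OF pos_n])
    qed
  qed
  then show ?thesis
    using integrable_W by (simp add: w_def)
qed

end
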